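(* Let $K$ be an arbitrary field, $m\geq 4$, $\Gamma\in\mathbb{S}(m)$. Suppose that $s=|\operatorname{ind}(\Gamma)|\geq 2$ and $\operatorname{dec}(\Gamma)_{\geq 2}\neq\emptyset$, and let $\operatorname{ind}(\Gamma)=\{\nu_1,\ldots,\nu_s\}$. Then the set $\mathcal{A}(m,\Gamma)$ is an affine algebraic variety and the algebra of regular functions on it, $\mathcal{O}(\mathcal{A}(m,\Gamma))$, is the factor algebra of the polynomial algebra $$P(m,\Gamma):=K[\lambda_{\nu_i,j}\mid i=1,\ldots,s;\ j\in C\Gamma(\nu_i)]$$ in $n(m,\Gamma):=\sum_{i=1}^s|C\Gamma(\nu_i)|$ variables $\lambda_{\nu_i,j}$ by the defining relations: for each pair $(\nu_i,\gamma)\in\operatorname{ind}(\Gamma)\times\Gamma$ with $\nu_i+\gamma\in\Gamma$ and $e_i+a(\gamma)\neq a(\nu_i+\gamma)$, and each $j\in C\Gamma(\nu_i+\gamma)$, $$c_j\Big(f_{\nu_i}f^{a(\gamma)}-f^{a(\nu_i+\gamma)}-\sum_{\delta\in\Gamma(\nu_i+\gamma)}\eta_{\nu_i,a(\gamma);\delta}f^{a(\delta)}\Big)=0,$$ i.e. $$\partial^{[j]}\Big(f_{\nu_i}f^{a(\gamma)}-f^{a(\nu_i+\gamma)}-\sum_{\delta\in\Gamma(\nu_i+\gamma)}\eta_{\nu_i,a(\gamma);\delta}f^{a(\delta)}\Big)\Big|_{x=0}=0.$$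
   Context: $\mathbb{S}(m)$ is the set consisting of the empty set and of all non-empty subsets $\Gamma\subseteq\{2,\ldots,m-2\}$ such that $\Gamma+\Gamma\subseteq\Gamma\cup[m,\infty)$. An element of $\Gamma$ is decomposable if it is a sum of two elements of $\Gamma$; $\operatorname{ind}(\Gamma)$ and $\operatorname{dec}(\Gamma)$ are the sets of indecomposable and decomposable elements. Write $\operatorname{ind}(\Gamma)=\{\nu_1<\cdots<\nu_s\}$, $\nu=(\nu_1,\ldots,\nu_s)$, $a\nu:=\sum_ia_i\nu_i$ for $a\in\mathbb{N}^s$ ($0\in\mathbb N$). For $\gamma\in\operatorname{dec}(\Gamma)$, $\operatorname{Rel}(\gamma):=\{a\in\mathbb{N}^s\mid a\nu=\gamma\}$; $\operatorname{dec}(\Gamma)_{\geq 2}:=\{\gamma\in\operatorname{dec}(\Gamma)\mid|\operatorname{Rel}(\gamma)|\geq 2\}$. For each $\gamma\in\operatorname{dec}(\Gamma)$ an element $a(\gamma)\in\operatorname{Rel}(\gamma)$ is fixed (arbitrarily), and $a(\nu_i):=e_i$, the $i$-th standard basis vector. $\Gamma(k):=\{\gamma\in\Gamma\mid\gamma>k\}$, $\Gamma(k,l):=\{\gamma\in\Gamma\mid k<\gamma<l\}$, $C\Gamma(k):=\{\delta\mid\delta\notin\Gamma,k<\delta\leq m-1\}$. $\mathcal{A}(m)$ is the set of all $K$-subalgebras $A$ of $K[x]$ such that $x^mK[x]\subset A$ and $x^{m-1}\notin A$. For $A\in\mathcal{A}(m)$, $\Gamma_A\in\mathbb{S}(m)$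 is the set of integers $\gamma$ with $1\leq\gamma\leq m-1$ such that $A$ contains an element of the form $x^\gamma+\sum_{j>\gamma}\lambda_jx^j$. $\mathcal{A}(m,\Gamma):=\{A\in\mathcal{A}(m)\mid\Gamma_A=\Gamma\}$. For $A\in\mathcal{A}(m,\Gamma)$, $\overline{A}:=A/x^mK[x]\subseteq K[x]/x^mK[x]$ has a unique $K$-basis $\{1,f_\gamma\mid\gamma\in\Gamma\}$ (the canonical basis) with $f_\gamma=x^\gamma+\sum_{\delta\in C\Gamma(\gamma)}\lambda_{\gamma,\delta}x^\delta$. The coefficients $\lambda_{\nu_i,j}$ ($i=1,\ldots,s$, $j\in C\Gamma(\nu_i)$) of $f_{\nu_1},\ldots,f_{\nu_s}$ uniquely determine $A$ and are treated as regular functions (coordinates) on $\mathcal{A}(m,\Gamma)$, which is thus viewed as a subset of affine space of dimension $n(m,\Gamma)$. In the relations, $\lambda_{\nu_i,j}$ are indeterminates, $f_{\nu_i}=x^{\nu_i}+\sum_{j\in C\Gamma(\nu_i)}\lambda_{\nu_i,j}x^j\in P(m,\Gamma)[x]$, $f^a:=\prod_{i=1}^sf_{\nu_i}^{a_i}$ for $a\in\mathbb{N}^s$, $c_j(f)$ is the coefficient of $x^j$ in $f$, and $\partial^{[j]}=\frac{1}{j!}\frac{d^j}{dx^j}$ is the divided power derivation, $\partial^{[j]}(x^k)=\binom{k}{j}x^{k-j}$ for $k\geq j$ and $0$ for $k<j$ (so $c_j(f)=\partial^{[j]}(f)|_{x=0}$). For fixed $\nu_i$ and $\gamma\in\Gamma$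 with $\nu_i+\gamma\in\Gamma$, the polynomials $\eta_{\nu_i,a(\gamma);\delta}\in P(m,\Gamma)$, $\delta\in\Gamma(\nu_i+\gamma)$, are the unique solution of the unitriangular linear system $$\eta_{\nu_i,a(\gamma);\delta}+\sum_{\delta'\in\Gamma(\nu_i+\gamma,\delta)}\eta_{\nu_i,a(\gamma);\delta'}\,c_\delta\big(f^{a(\delta')}\big)=c_\delta\big(f_{\nu_i}f^{a(\gamma)}-f^{a(\nu_i+\gamma)}\big),\quad\delta\in\Gamma(\nu_i+\gamma).$$ *)

theory Defs
  imports "HOL-Algebra.Algebraic_Closure_Type" "HOL-Algebra.UnivPoly"
    "HOL-Computational_Algebra.Polynomial" "HOL-Library.Poly_Mapping"
begin

section \<open>The sets \<open>\<Gamma>\<close>\<close>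

definition SS :: "nat \<Rightarrow> nat set set" where
  "SS m = {\<Gamma>. \<Gamma> = {} \<or>
     (\<Gamma> \<noteq> {} \<and> \<Gamma> \<subseteq> {2..m - 2} \<and> (\<forall>\<alpha>\<in>\<Gamma>. \<forall>\<beta>\<in>\<Gamma>. \<alpha> + \<beta> \<in> \<Gamma> \<union> {m..}))}"

definition dec :: "nat set \<Rightarrow> nat set" where
  "dec \<Gamma> = {\<gamma> \<in> \<Gamma>. \<exists>\<alpha>\<in>\<Gamma>. \<exists>\<beta>\<in>\<Gamma>. \<gamma> = \<alpha> + \<beta>}"

definition ind :: "nat set \<Rightarrow> nat set" where
  "ind \<Gamma> = \<Gamma> - dec \<Gamma>"

text \<open>
  Vectors in \<open>\<nat>\<^sup>s\<close>, where \<open>ind \<Gamma> = {\<nu>\<^sub>1 < \<dots> < \<nu>\<^sub>s}\<close>, are indexed by the elements \<open>\<nu>\<^sub>i\<close> themselves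
  instead of by \<open>i\<close>: they are functions \<open>nat \<Rightarrow> nat\<close> that vanish outside \<open>ind \<Gamma>\<close>, and
  the standard basis vector \<open>e\<^sub>i\<close> is \<open>unit_vec \<nu>\<^sub>i\<close>.
\<close>

definition unit_vec :: "nat \<Rightarrow> nat \<Rightarrow> nat" where
  "unit_vec \<nu> = (\<lambda>\<mu>. if \<mu> = \<nu> then 1 else 0)"

definition Rel :: "nat set \<Rightarrow> nat \<Rightarrow> (nat \<Rightarrow> nat) set" where
  "Rel \<Gamma> \<gamma> = {a. (\<forall>\<mu>. \<mu> \<notin> ind \<Gamma> \<longrightarrow> a \<mu> = 0) \<and> (\<Sum>\<nu>\<in>ind \<Gamma>. a \<nu> * \<nu>) = \<gamma>}"

definition dec_ge2 :: "nat set \<Rightarrow> nat set" where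
  "dec_ge2 \<Gamma> = {\<gamma> \<in> dec \<Gamma>. card (Rel \<Gamma> \<gamma>) \<ge> 2}"

definition above :: "nat set \<Rightarrow> nat \<Rightarrow> nat set" where
  "above \<Gamma> k = {\<gamma> \<in> \<Gamma>. \<gamma> > k}"

definition between :: "nat set \<Rightarrow> nat \<Rightarrow> nat \<Rightarrow> nat set" where
  "between \<Gamma> k l = {\<gamma> \<in> \<Gamma>. k < \<gamma> \<and> \<gamma> < l}"

definition CC :: "nat \<Rightarrow> nat set \<Rightarrow> nat \<Rightarrow> nat set" where
  "CC m \<Gamma> k = {\<delta>. \<delta> \<notin> \<Gamma> \<and> k < \<delta> \<and> \<delta> \<le> m - 1}"

section \<open>The set \<open>\<A>(m, \<Gamma>)\<close> and its coordinates\<close>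

definition is_subalgebra :: "'k::field poly set \<Rightarrow> bool" where
  "is_subalgebra A \<longleftrightarrow> 1 \<in> A \<and> (\<forall>f\<in>A. \<forall>g\<in>A. f + g \<in> A \<and> f * g \<in> A) \<and>
     (\<forall>c. \<forall>f\<in>A. Polynomial.smult c f \<in> A)"

definition algebras :: "nat \<Rightarrow> 'k::field poly set set" where
  "algebras m = {A. is_subalgebra A \<and> (\<forall>g. Polynomial.monom 1 m * g \<in> A) \<and>
     Polynomial.monom 1 (m - 1) \<notin> A}"

definition Gamma_of :: "nat \<Rightarrow> 'k::field poly set \<Rightarrow> nat set" where
  "Gamma_of m A = {\<gamma>. 1 \<le> \<gamma> \<and> \<gamma> \<le> m - 1 \<and>
     (\<exists>f\<in>A. poly.coeff f \<gamma> = 1 \<and> (\<forall>j<\<gamma>. poly.coeff f j = 0))}"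

definition algebras_of_type :: "nat \<Rightarrow> nat set \<Rightarrow> 'k::field poly set set" where
  "algebras_of_type m \<Gamma> = {A \<in> algebras m. Gamma_of m A = \<Gamma>}"

text \<open>
  Elements of \<open>A / x\<^sup>m K[x]\<close> are represented by the unique element of \<open>A\<close> of degree less
  than \<open>m\<close> in the residue class; note that \<open>x\<^sup>m K[x] \<subseteq> A\<close>.
\<close>

definition canonical :: "nat \<Rightarrow> nat set \<Rightarrow> 'k::field poly set \<Rightarrow> nat \<Rightarrow> 'k poly" where
  "canonical m \<Gamma> A \<gamma> = (THE f. f \<in> A \<and> poly.coeff f \<gamma> = 1 \<and>
     (\<forall>j. j \<noteq> \<gamma> \<longrightarrow> j \<notin> CC m \<Gamma> \<gamma> \<longrightarrow> poly.coeff f j = 0))"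

text \<open>The pairs \<open>(\<nu>\<^sub>i, j)\<close> that index the variables \<open>\<lambda>\<^bsub>\<nu>\<^sub>i,j\<^esub>\<close>.\<close>

definition Idx :: "nat \<Rightarrow> nat set \<Rightarrow> (nat \<times> nat) set" where
  "Idx m \<Gamma> = (SIGMA \<nu>:ind \<Gamma>. CC m \<Gamma> \<nu>)"

definition coords :: "nat \<Rightarrow> nat set \<Rightarrow> 'k::field poly set \<Rightarrow> nat \<times> nat \<Rightarrow> 'k" where
  "coords m \<Gamma> A = restrict (\<lambda>(\<nu>, j). poly.coeff (canonical m \<Gamma> A \<nu>) j) (Idx m \<Gamma>)"

section \<open>The polynomial algebra \<open>P(m, \<Gamma>)\<close> and the relations\<close>

type_synonym 'k mpoly = "(nat \<times> nat \<Rightarrow>\<^sub>0 nat) \<Rightarrow>\<^sub>0 'k"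

definition mconst :: "'k::field \<Rightarrow> 'k mpoly" where
  "mconst c = Poly_Mapping.single 0 c"

definition lam :: "nat \<Rightarrow> nat \<Rightarrow> 'k::field mpoly" where
  "lam \<nu> j = Poly_Mapping.single (Poly_Mapping.single (\<nu>, j) 1) 1"

definition PP :: "nat \<Rightarrow> nat set \<Rightarrow> 'k::field mpoly ring" where
  "PP m \<Gamma> = \<lparr> carrier = {p. \<forall>t\<in>Poly_Mapping.keys p. Poly_Mapping.keys t \<subseteq> Idx m \<Gamma>},
     monoid.mult = (*), monoid.one = 1, ring.zero = 0, ring.add = (+) \<rparr>"

definition gen_f :: "nat \<Rightarrow> nat set \<Rightarrow> nat \<Rightarrow> 'k::field mpoly poly" where
  "gen_f m \<Gamma> \<nu> = Polynomial.monom 1 \<nu> + (\<Sum>j\<in>CC m \<Gamma> \<nu>. Polynomial.monom (lam \<nu> j) j)"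

definition fpow :: "nat \<Rightarrow> nat set \<Rightarrow> (nat \<Rightarrow> nat) \<Rightarrow> 'k::field mpoly poly" where
  "fpow m \<Gamma> a = (\<Prod>\<nu>\<in>ind \<Gamma>. gen_f m \<Gamma> \<nu> ^ a \<nu>)"

definition divided_deriv :: "nat \<Rightarrow> 'a::comm_ring_1 poly \<Rightarrow> 'a poly" where
  "divided_deriv j p =
     (\<Sum>k\<in>{j..Polynomial.degree p}. Polynomial.monom (of_nat (k choose j) * poly.coeff p k) (k - j))"

definition eta :: "nat \<Rightarrow> nat set \<Rightarrow> (nat \<Rightarrow> nat \<Rightarrow> nat) \<Rightarrow> nat \<Rightarrow> nat \<Rightarrow> nat \<Rightarrow> 'k::field mpoly" where
  "eta m \<Gamma> a \<nu> \<gamma> = (THE h.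
     (\<forall>\<delta>. \<delta> \<notin> above \<Gamma> (\<nu> + \<gamma>) \<longrightarrow> h \<delta> = 0) \<and>
     (\<forall>\<delta>\<in>above \<Gamma> (\<nu> + \<gamma>).
        h \<delta> + (\<Sum>\<delta>'\<in>between \<Gamma> (\<nu> + \<gamma>) \<delta>. h \<delta>' * poly.coeff (fpow m \<Gamma> (a \<delta>')) \<delta>) =
        poly.coeff (gen_f m \<Gamma> \<nu> * fpow m \<Gamma> (a \<gamma>) - fpow m \<Gamma> (a (\<nu> + \<gamma>))) \<delta>))"

definition relpoly ::
  "nat \<Rightarrow> nat set \<Rightarrow> (nat \<Rightarrow> nat \<Rightarrow> nat) \<Rightarrow> nat \<Rightarrow> nat \<Rightarrow> 'k::field mpoly poly" where
  "relpoly m \<Gamma> a \<nu> \<gamma> = gen_f m \<Gamma> \<nu> * fpow m \<Gamma> (a \<gamma>) - fpow m \<Gamma> (a (\<nu> + \<gamma>)) -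
     (\<Sum>\<delta>\<in>above \<Gamma> (\<nu> + \<gamma>). Polynomial.smult (eta m \<Gamma> a \<nu> \<gamma> \<delta>) (fpow m \<Gamma> (a \<delta>)))"

definition rel_index :: "nat \<Rightarrow> nat set \<Rightarrow> (nat \<Rightarrow> nat \<Rightarrow> nat) \<Rightarrow> (nat \<times> nat \<times> nat) set" where
  "rel_index m \<Gamma> a = {(\<nu>, \<gamma>, j). \<nu> \<in> ind \<Gamma> \<and> \<gamma> \<in> \<Gamma> \<and> \<nu> + \<gamma> \<in> \<Gamma> \<and>
     (\<lambda>\<mu>. unit_vec \<nu> \<mu> + a \<gamma> \<mu>) \<noteq> a (\<nu> + \<gamma>) \<and> j \<in> CC m \<Gamma> (\<nu> + \<gamma>)}"

definition relations ::
  "nat \<Rightarrow> nat set \<Rightarrow> (nat \<Rightarrow> nat \<Rightarrow> nat) \<Rightarrow> 'k::field mpoly set" where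
  "relations m \<Gamma> a = (\<lambda>(\<nu>, \<gamma>, j). poly.coeff (relpoly m \<Gamma> a \<nu> \<gamma>) j) ` rel_index m \<Gamma> a"

definition relations_deriv ::
  "nat \<Rightarrow> nat set \<Rightarrow> (nat \<Rightarrow> nat \<Rightarrow> nat) \<Rightarrow> 'k::field mpoly set" where
  "relations_deriv m \<Gamma> a =
     (\<lambda>(\<nu>, \<gamma>, j). poly (divided_deriv j (relpoly m \<Gamma> a \<nu> \<gamma>)) 0) ` rel_index m \<Gamma> a"

section \<open>Points over \<open>K\<close>-algebras and regular functions\<close>

text \<open>
  Over an arbitrary field (for instance a finite one), regular functions on a variety are not
  determined by their values at the \<open>K\<close>-points. They are therefore treated as functions on the
  \<open>R\<close>-points of \<open>\<A>(m, \<Gamma>)\<close> for all commutative \<open>K\<close>-algebras \<open>R\<close> (given by their structure map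
  \<open>\<phi> : K \<rightarrow> R\<close>).
\<close>

definition comm_algebra :: "'r ring \<Rightarrow> ('k::field \<Rightarrow> 'r) \<Rightarrow> bool" where
  "comm_algebra R \<phi> \<longleftrightarrow> cring R \<and> \<phi> \<in> ring_hom (ring_of_type_algebra :: 'k ring) R"

text \<open>
  The \<open>R\<close>-points are the \<open>R\<close>-subalgebras \<open>A\<close> of \<open>R[x]\<close> that contain \<open>x\<^sup>m R[x]\<close> such that, for
  \<open>1 \<le> \<gamma> < m\<close>, the ideal of all \<open>c \<in> R\<close> for which \<open>A\<close> contains an element of the form
  \<open>c x\<^sup>\<gamma> + (higher terms)\<close> is \<open>R\<close> if \<open>\<gamma> \<in> \<Gamma>\<close> and \<open>0\<close> otherwise. Over a field this says
  \<open>\<Gamma>\<^sub>A = \<Gamma>\<close> (see \<open>points_field\<close> below); in general it says that \<open>A / x\<^sup>m R[x]\<close> has an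
  \<open>R\<close>-basis of the canonical form. The elements of \<open>UP R\<close> are coefficient functions.
\<close>

definition points :: "'r ring \<Rightarrow> nat \<Rightarrow> nat set \<Rightarrow> (nat \<Rightarrow> 'r) set set" where
  "points R m \<Gamma> = {A. subring A (UP R) \<and>
     (\<forall>c\<in>carrier R. \<forall>f\<in>A. c \<odot>\<^bsub>UP R\<^esub> f \<in> A) \<and>
     (\<forall>g\<in>carrier (UP R). up_ring.monom (UP R) \<one>\<^bsub>R\<^esub> m \<otimes>\<^bsub>UP R\<^esub> g \<in> A) \<and>
     (\<forall>\<gamma>\<in>\<Gamma>. \<exists>f\<in>A. f \<gamma> = \<one>\<^bsub>R\<^esub> \<and> (\<forall>j<\<gamma>. f j = \<zero>\<^bsub>R\<^esub>)) \<and>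
     (\<forall>\<gamma>\<in>{1..m - 1} - \<Gamma>. \<forall>f\<in>A. (\<forall>j<\<gamma>. f j = \<zero>\<^bsub>R\<^esub>) \<longrightarrow> f \<gamma> = \<zero>\<^bsub>R\<^esub>)}"

definition canonical_over ::
  "'r ring \<Rightarrow> nat \<Rightarrow> nat set \<Rightarrow> (nat \<Rightarrow> 'r) set \<Rightarrow> nat \<Rightarrow> nat \<Rightarrow> 'r" where
  "canonical_over R m \<Gamma> A \<gamma> = (THE f. f \<in> A \<and> f \<gamma> = \<one>\<^bsub>R\<^esub> \<and>
     (\<forall>j. j \<noteq> \<gamma> \<longrightarrow> j \<notin> CC m \<Gamma> \<gamma> \<longrightarrow> f j = \<zero>\<^bsub>R\<^esub>))"

definition coords_over ::
  "'r ring \<Rightarrow> nat \<Rightarrow> nat set \<Rightarrow> (nat \<Rightarrow> 'r) set \<Rightarrow> nat \<times> nat \<Rightarrow> 'r" where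
  "coords_over R m \<Gamma> A = restrict (\<lambda>(\<nu>, j). canonical_over R m \<Gamma> A \<nu> j) (Idx m \<Gamma>)"

definition mpoly_eval ::
  "'r ring \<Rightarrow> ('k::field \<Rightarrow> 'r) \<Rightarrow> (nat \<times> nat \<Rightarrow> 'r) \<Rightarrow> 'k mpoly \<Rightarrow> 'r" where
  "mpoly_eval R \<phi> v p = (\<Oplus>\<^bsub>R\<^esub>t\<in>Poly_Mapping.keys p. \<phi> (Poly_Mapping.lookup p t) \<otimes>\<^bsub>R\<^esub>
     (\<Otimes>\<^bsub>R\<^esub>i\<in>Poly_Mapping.keys t. v i [^]\<^bsub>R\<^esub> Poly_Mapping.lookup t i))"

definition zero_set ::
  "'r ring \<Rightarrow> ('k::field \<Rightarrow> 'r) \<Rightarrow> nat \<Rightarrow> nat set \<Rightarrow> 'k mpoly set \<Rightarrow> (nat \<times> nat \<Rightarrow> 'r) set" where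
  "zero_set R \<phi> m \<Gamma> S =
     {v \<in> Idx m \<Gamma> \<rightarrow>\<^sub>E carrier R. \<forall>p\<in>S. mpoly_eval R \<phi> v p = \<zero>\<^bsub>R\<^esub>}"

text \<open>
  For regular functions it is enough to let \<open>R\<close> range over the \<open>K\<close>-algebras whose carrier is a
  set of elements of type \<open>'k mpoly set\<close>: every quotient of \<open>P(m, \<Gamma>)\<close> is one of them, and the
  coordinates of an \<open>R\<close>-point generate a \<open>K\<close>-algebra isomorphic to such a quotient.
\<close>

type_synonym 'k point =
  "'k mpoly set ring \<times> ('k \<Rightarrow> 'k mpoly set) \<times> (nat \<Rightarrow> 'k mpoly set) set"

definition all_points :: "nat \<Rightarrow> nat set \<Rightarrow> 'k::field point set" where
  "all_points m \<Gamma> = {(R, \<phi>, A). comm_algebra R \<phi> \<and> A \<in> points R m \<Gamma>}"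

text \<open>
  The function on \<open>\<A>(m, \<Gamma>)\<close> given by a polynomial in the coordinates; the variable
  \<open>\<lambda>\<^bsub>\<nu>\<^sub>i,j\<^esub>\<close> gives the corresponding coordinate function.
\<close>

definition reg_fun :: "nat \<Rightarrow> nat set \<Rightarrow> 'k::field mpoly \<Rightarrow> 'k point \<Rightarrow> 'k mpoly set" where
  "reg_fun m \<Gamma> p = restrict (\<lambda>(R, \<phi>, A). mpoly_eval R \<phi> (coords_over R m \<Gamma> A) p) (all_points m \<Gamma>)"

text \<open>The algebra \<open>\<O>(\<A>(m, \<Gamma>))\<close>, with pointwise operations.\<close>

definition reg_ring :: "nat \<Rightarrow> nat set \<Rightarrow> ('k::field point \<Rightarrow> 'k mpoly set) ring" where
  "reg_ring m \<Gamma> = \<lparr> carrier = reg_fun m \<Gamma> ` carrier (PP m \<Gamma>),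
     monoid.mult = (\<lambda>F G. restrict (\<lambda>z. F z \<otimes>\<^bsub>fst z\<^esub> G z) (all_points m \<Gamma>)),
     monoid.one = restrict (\<lambda>z. \<one>\<^bsub>fst z\<^esub>) (all_points m \<Gamma>),
     ring.zero = restrict (\<lambda>z. \<zero>\<^bsub>fst z\<^esub>) (all_points m \<Gamma>),
     ring.add = (\<lambda>F G. restrict (\<lambda>z. F z \<oplus>\<^bsub>fst z\<^esub> G z) (all_points m \<Gamma>)) \<rparr>"

section \<open>The \<open>K\<close>-points are the elements of \<open>\<A>(m, \<Gamma>)\<close>\<close>

context
  fixes K :: "'k::field ring"
  defines "K \<equiv> ring_of_type_algebra"
begin

lemma K_simps:
  "carrier K = UNIV" "x \<otimes>\<^bsub>K\<^esub> y = x * y" "x \<oplus>\<^bsub>K\<^esub> y = x + y" "\<one>\<^bsub>K\<^esub> = 1" "\<zero>\<^bsub>K\<^esub> = 0"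
  by (simp_all add: K_def ring_of_type_algebra_def)

lemma K_UP: "UP_cring K"
  unfolding K_def by (rule UP_cring.intro) (rule cring_from_type_algebra)

lemma K_finsum: "finite S \<Longrightarrow> finsum K f S = sum f S"
proof (induction S rule: finite_induct)
  interpret UP_cring K "UP K" by (rule K_UP)
  case empty
  show ?case by (simp add: K_simps)
next
  interpret UP_cring K "UP K" by (rule K_UP)
  case (insert x F)
  then show ?case by (simp add: K_simps)
qed

lemma K_up: "carrier (UP K) = range poly.coeff"
proof -
  have "f \<in> up K \<longleftrightarrow> f \<in> range poly.coeff" for f :: "nat \<Rightarrow> 'k"
  proof
    assume "f \<in> up K"
    then obtain n where "bound 0 n f"
      by (auto simp: up_def K_simps)
    hence "f i = 0" if "i > n" for i
      using that by (auto dest: bound.bound)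
    hence "poly.coeff (Abs_poly f) = f"
      by (intro coeff_Abs_poly)
    thus "f \<in> range poly.coeff" by (metis rangeI)
  next
    assume "f \<in> range poly.coeff"
    then obtain p where "f = poly.coeff p" by auto
    thus "f \<in> up K"
      by (auto simp: up_def K_simps intro!: exI[of _ "Polynomial.degree p"] bound.intro Polynomial.coeff_eq_0)
  qed
  thus ?thesis by (auto simp: UP_def)
qed

lemma K_UP_simps:
  "poly.coeff p \<oplus>\<^bsub>UP K\<^esub> poly.coeff q = poly.coeff (p + q)"
  "poly.coeff p \<otimes>\<^bsub>UP K\<^esub> poly.coeff q = poly.coeff (p * q)"
  "c \<odot>\<^bsub>UP K\<^esub> poly.coeff p = poly.coeff (Polynomial.smult c p)"
  "up_ring.monom (UP K) 1 n = poly.coeff (Polynomial.monom 1 n)"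
  "\<one>\<^bsub>UP K\<^esub> = poly.coeff 1"
  "\<zero>\<^bsub>UP K\<^esub> = poly.coeff 0"
proof -
  have up: "poly.coeff p \<in> up K" for p
    using K_up by (auto simp: UP_def)
  show "poly.coeff p \<oplus>\<^bsub>UP K\<^esub> poly.coeff q = poly.coeff (p + q)"
    "poly.coeff p \<otimes>\<^bsub>UP K\<^esub> poly.coeff q = poly.coeff (p * q)"
    "c \<odot>\<^bsub>UP K\<^esub> poly.coeff p = poly.coeff (Polynomial.smult c p)"
    "up_ring.monom (UP K) 1 n = poly.coeff (Polynomial.monom 1 n)"
    "\<one>\<^bsub>UP K\<^esub> = poly.coeff 1"
    "\<zero>\<^bsub>UP K\<^esub> = poly.coeff 0"
    using up by (auto simp: UP_def K_simps K_finsum coeff_mult fun_eq_iff)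
qed

lemma K_subring:
  assumes "\<forall>c. \<forall>f\<in>A. Polynomial.smult c f \<in> A"
  shows "subring (poly.coeff ` A) (UP K) \<longleftrightarrow>
    1 \<in> A \<and> (\<forall>f\<in>A. \<forall>g\<in>A. f + g \<in> A \<and> f * g \<in> A)"
proof -
  interpret UP_cring K "UP K" by (rule K_UP)
  have inj: "poly.coeff p \<in> poly.coeff ` A \<longleftrightarrow> p \<in> A" for p
    by (auto simp: poly.coeff_inject)
  show ?thesis
  proof
    assume "subring (poly.coeff ` A) (UP K)"
    note S = subringE[OF this]
    have "f + g \<in> A" "f * g \<in> A" if "f \<in> A" "g \<in> A" for f g
      using S(7)[of "poly.coeff f" "poly.coeff g"] S(6)[of "poly.coeff f" "poly.coeff g"] that
      by (auto simp: inj K_UP_simps)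
    moreover have "1 \<in> A"
      using S(3) by (simp add: inj K_UP_simps)
    ultimately show "1 \<in> A \<and> (\<forall>f\<in>A. \<forall>g\<in>A. f + g \<in> A \<and> f * g \<in> A)" by blast
  next
    assume *: "1 \<in> A \<and> (\<forall>f\<in>A. \<forall>g\<in>A. f + g \<in> A \<and> f * g \<in> A)"
    show "subring (poly.coeff ` A) (UP K)"
    proof (rule P.subringI)
      show "poly.coeff ` A \<subseteq> carrier (UP K)" by (auto simp: K_up)
      show "\<one>\<^bsub>UP K\<^esub> \<in> poly.coeff ` A" using * by (simp add: K_UP_simps)
      fix h assume "h \<in> poly.coeff ` A"
      then obtain f where f: "f \<in> A" "h = poly.coeff f" by blast
      have "\<ominus>\<^bsub>UP K\<^esub> h = poly.coeff (- f)"
        by (rule P.minus_equality) (auto simp: f K_UP_simps K_up)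
      moreover have "- f \<in> A" using assms f(1) by (metis smult_1_left smult_minus_left)
      ultimately show "\<ominus>\<^bsub>UP K\<^esub> h \<in> poly.coeff ` A" by auto
    qed (use * in \<open>auto simp: K_UP_simps\<close>)
  qed
qed

lemma points_field_iff:
  assumes "m \<ge> 4" "\<Gamma> \<in> SS m"
  shows "poly.coeff ` A \<in> points K m \<Gamma> \<longleftrightarrow> A \<in> algebras_of_type m \<Gamma>"
proof -
  have inj: "poly.coeff p \<in> poly.coeff ` A \<longleftrightarrow> p \<in> A" for p
    by (auto simp: poly.coeff_inject)
  have \<Gamma>: "\<Gamma> \<subseteq> {2..m - 2}" using assms(2) by (auto simp: SS_def)
  have lead: "(\<forall>\<gamma>\<in>{1..m - 1} - \<Gamma>. \<forall>f\<in>A. (\<forall>j<\<gamma>. poly.coeff f j = 0) \<longrightarrow> poly.coeff f \<gamma> = 0) \<longleftrightarrow>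
      Gamma_of m A \<subseteq> \<Gamma>" if sm: "\<forall>c. \<forall>f\<in>A. Polynomial.smult c f \<in> A"
  proof safe
    fix \<gamma> assume *: "\<forall>\<gamma>\<in>{1..m - 1} - \<Gamma>. \<forall>f\<in>A. (\<forall>j<\<gamma>. poly.coeff f j = 0) \<longrightarrow> poly.coeff f \<gamma> = 0"
      "\<gamma> \<in> Gamma_of m A"
    then obtain f where "f \<in> A" "poly.coeff f \<gamma> = 1" "\<forall>j<\<gamma>. poly.coeff f j = 0" "\<gamma> \<in> {1..m-1}"
      by (auto simp: Gamma_of_def)
    with *(1) show "\<gamma> \<in> \<Gamma>" by (metis DiffI zero_neq_one)
  next
    fix \<gamma> f assume *: "Gamma_of m A \<subseteq> \<Gamma>" "\<gamma> \<in> {1..m - 1}" "f \<in> A"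
      "\<forall>j<\<gamma>. poly.coeff f j = 0" "\<gamma> \<notin> \<Gamma>"
    show "poly.coeff f \<gamma> = 0"
    proof (rule ccontr)
      assume nz: "poly.coeff f \<gamma> \<noteq> 0"
      define g where "g = Polynomial.smult (inverse (poly.coeff f \<gamma>)) f"
      have "g \<in> A" using sm *(3) by (auto simp: g_def)
      moreover have "poly.coeff g \<gamma> = 1" "\<forall>j<\<gamma>. poly.coeff g j = 0"
        using nz *(4) by (auto simp: g_def)
      ultimately have "\<gamma> \<in> Gamma_of m A" using *(2) by (auto simp: Gamma_of_def)
      thus False using * by auto
    qed
  qed
  have \<Gamma>2: "(\<forall>\<gamma>\<in>\<Gamma>. \<exists>f\<in>A. poly.coeff f \<gamma> = 1 \<and> (\<forall>j<\<gamma>. poly.coeff f j = 0)) \<longleftrightarrow> \<Gamma> \<subseteq> Gamma_of m A"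
    using \<Gamma> by (fastforce simp: Gamma_of_def)
  have top: "Polynomial.monom 1 (m - 1) \<notin> A" if "Gamma_of m A = \<Gamma>"
  proof
    assume "Polynomial.monom 1 (m - 1) \<in> A"
    hence "m - 1 \<in> Gamma_of m A" using assms(1) unfolding Gamma_of_def
      by (auto intro!: bexI[of _ "Polynomial.monom 1 (m - 1)"])
    hence "m - 1 \<le> m - 2" using that \<Gamma> by (meson atLeastAtMost_iff subset_iff equalityD1)
    thus False using assms(1) by simp
  qed
  have pts: "poly.coeff ` A \<in> points K m \<Gamma> \<longleftrightarrow>
    subring (poly.coeff ` A) (UP K) \<and> (\<forall>c. \<forall>f\<in>A. Polynomial.smult c f \<in> A) \<and>
    (\<forall>g. Polynomial.monom 1 m * g \<in> A) \<and>
    (\<forall>\<gamma>\<in>\<Gamma>. \<exists>f\<in>A. poly.coeff f \<gamma> = 1 \<and> (\<forall>j<\<gamma>. poly.coeff f j = 0)) \<and>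
    (\<forall>\<gamma>\<in>{1..m - 1} - \<Gamma>. \<forall>f\<in>A. (\<forall>j<\<gamma>. poly.coeff f j = 0) \<longrightarrow> poly.coeff f \<gamma> = 0)"
    unfolding points_def mem_Collect_eq K_simps K_up by (simp add: K_UP_simps inj)
  show ?thesis
    unfolding pts algebras_of_type_def algebras_def is_subalgebra_def mem_Collect_eq \<Gamma>2
    using lead K_subring[of A] top by (safe; blast)
qed

lemma points_field:
  assumes "m \<ge> 4" "\<Gamma> \<in> SS m"
  shows "points K m \<Gamma> = (`) poly.coeff ` algebras_of_type m \<Gamma>"
proof (rule Set.set_eqI)
  fix B :: "(nat \<Rightarrow> 'k) set"
  show "B \<in> points K m \<Gamma> \<longleftrightarrow> B \<in> (`) poly.coeff ` algebras_of_type m \<Gamma>"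
  proof
    assume B: "B \<in> points K m \<Gamma>"
    interpret UP_cring K "UP K" by (rule K_UP)
    have "B \<subseteq> carrier (UP K)"
      using B by (auto simp: points_def dest: subringE(1))
    hence eq: "poly.coeff ` (poly.coeff -` B) = B" by (auto simp: K_up)
    hence "poly.coeff -` B \<in> algebras_of_type m \<Gamma>"
      using B points_field_iff[OF assms, of "poly.coeff -` B"] by simp
    thus "B \<in> (`) poly.coeff ` algebras_of_type m \<Gamma>"
      using eq by (intro image_eqI[where x = "poly.coeff -` B"]) simp_all
  next
    assume "B \<in> (`) poly.coeff ` algebras_of_type m \<Gamma>"
    then obtain A where "A \<in> algebras_of_type m \<Gamma>" "B = poly.coeff ` A" by blast
    thus "B \<in> points K m \<Gamma>" using points_field_iff[OF assms, of A] by simp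
  qed
qed

end

end

theory Submission
  imports Defs
begin

text \<open>
  Let \<open>V\<close> be the \<open>R\<close>-span of \<open>1\<close>, the \<open>f\<^bsup>a(\<gamma>)\<^esup>\<close> for \<open>\<gamma> \<in> \<Gamma>\<close>, and \<open>x\<^sup>m R[x]\<close>. Since \<open>f\<^bsup>a(\<gamma>)\<^esup>\<close> starts
  with \<open>x\<^sup>\<gamma>\<close>, an element of \<open>V\<close> whose coefficients at \<open>0\<close> and on \<open>\<Gamma>\<close> vanish lies in \<open>x\<^sup>m R[x]\<close>.
  The \<open>\<eta>\<close> are chosen so that the relation polynomial for \<open>(\<nu>, \<gamma>)\<close> has no coefficients on \<open>\<Gamma>\<close> or
  up to \<open>\<nu> + \<gamma>\<close>; hence the relations say exactly that \<open>f\<^bsub>\<nu>\<^esub> f\<^bsup>a(\<gamma>)\<^esup> \<in> V\<close>, that is, that \<open>V\<close> is closed under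
  multiplication by the generators \<open>f\<^bsub>\<nu>\<^esub>\<close> and so is a subalgebra. Conversely every point of
  \<open>\<A>(m, \<Gamma>)\<close> equals the \<open>V\<close> built from its canonical generators, so that the \<open>R\<close>-points are the zeros
  of the relations in \<open>R\<close>. For \<open>R = P(m, \<Gamma>) / I\<close>, with \<open>I\<close> generated by the relations, the residue
  classes of the variables form such a zero, and a polynomial that vanishes there lies in \<open>I\<close>.
\<close>

section \<open>Leading terms and the elements \<open>\<eta>\<close>\<close>

text \<open>This fixes the lowest term, not the top one: the polynomial starts with x^n and
  coefficient 1. The coefficient 1 lets orders add under products over any commutative ring.\<close>

definition lead_at :: "nat \<Rightarrow> 'a::comm_ring_1 poly \<Rightarrow> bool" where
  "lead_at n p \<longleftrightarrow> poly.coeff p n = 1 \<and> (\<forall>j<n. poly.coeff p j = 0)"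

text \<open>For k \<le> m + n a summand of the convolution survives only if i \<ge> m and k - i
  \<ge> n, which forces i = m and k = m + n.\<close>

lemma lead_at_mult:
  assumes "lead_at m p" "lead_at n q"
  shows "lead_at (m + n) (p * q)"
proof -
  have "poly.coeff (p * q) k = (if k = m + n then 1 else 0)" if "k \<le> m + n" for k
  proof -
    have "poly.coeff p i * poly.coeff q (k - i) = (if i = m \<and> k = m + n then 1 else 0)"
      if "i \<le> k" for i
      using that \<open>k \<le> m + n\<close> assms
      by (cases "i < m"; cases "k - i < n") (auto simp: lead_at_def)
    hence "poly.coeff (p * q) k = (\<Sum>i\<le>k. if i = m \<and> k = m + n then 1 else 0)"
      unfolding coeff_mult by (intro sum.cong) auto
    also have "\<dots> = (if k = m + n then 1 else 0)"
      by auto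
    finally show ?thesis .
  qed
  thus ?thesis by (simp add: lead_at_def)
qed

lemma lead_at_power: "lead_at n p \<Longrightarrow> lead_at (k * n) (p ^ k)"
proof (induction k)
  case 0
  show ?case by (simp add: lead_at_def)
next
  case (Suc k)
  thus ?case using lead_at_mult[of n p "k * n" "p ^ k"] by simp
qed

lemma lead_at_prod:
  assumes "\<And>i. i \<in> S \<Longrightarrow> lead_at (n i) (p i)"
  shows "lead_at (\<Sum>i\<in>S. n i) (\<Prod>i\<in>S. p i)"
  using assms
  by (induction S rule: infinite_finite_induct) (auto simp: lead_at_mult, auto simp: lead_at_def)

text \<open>At x = 0 only the summand k = j remains, with binomial coefficient 1. Nothing is divided
  by j!, so the characteristic does not matter.\<close>

lemma poly_divided_deriv_0: "poly (divided_deriv j p) 0 = poly.coeff p j"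
proof -
  have "poly (divided_deriv j p) 0 =
      (\<Sum>k\<in>{j..Polynomial.degree p}. if k = j then poly.coeff p j else 0)"
    unfolding divided_deriv_def poly_sum
    by (intro sum.cong) (auto simp: poly_monom power_0_left)
  also have "\<dots> = poly.coeff p j"
    using coeff_eq_0[of p j] by (auto simp: not_le)
  finally show ?thesis .
qed

section \<open>Forward substitution for unitriangular systems\<close>

function unitriangular_solution ::
  "nat set \<Rightarrow> (nat \<Rightarrow> nat \<Rightarrow> 'a::comm_ring_1) \<Rightarrow> (nat \<Rightarrow> 'a) \<Rightarrow> nat \<Rightarrow> 'a" where
  "unitriangular_solution D c b d =
     (if d \<in> D then b d - (\<Sum>d'\<in>{d' \<in> D. d' < d}. unitriangular_solution D c b d' * c d' d) else 0)"
  by auto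
termination by (relation "measure (\<lambda>(D, c, b, d). d)") auto

declare unitriangular_solution.simps [simp del]

text \<open>The equation at d involves only h d, with coefficient 1, and values below d, so strong
  induction determines h on D. The default 0 off D makes h unique as a total function.\<close>

lemma unitriangular_ex1:
  fixes c :: "nat \<Rightarrow> nat \<Rightarrow> 'a::comm_ring_1"
  shows "\<exists>!h. (\<forall>d. d \<notin> D \<longrightarrow> h d = 0) \<and>
    (\<forall>d\<in>D. h d + (\<Sum>d'\<in>{d' \<in> D. d' < d}. h d' * c d' d) = b d)"
proof (rule ex1I)
  let ?s = "unitriangular_solution D c b"
  have s: "?s d = (if d \<in> D then b d - (\<Sum>d'\<in>{d' \<in> D. d' < d}. ?s d' * c d' d) else 0)" for d
    by (rule unitriangular_solution.simps)
  have s1: "?s d = 0" if "d \<notin> D" for d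
    by (subst s) (simp add: that)
  have s2: "?s d = b d - (\<Sum>d'\<in>{d' \<in> D. d' < d}. ?s d' * c d' d)" if "d \<in> D" for d
    by (subst s) (simp add: that)
  show "(\<forall>d. d \<notin> D \<longrightarrow> ?s d = 0) \<and> (\<forall>d\<in>D. ?s d + (\<Sum>d'\<in>{d' \<in> D. d' < d}. ?s d' * c d' d) = b d)"
    using s1 s2 by (metis (no_types, lifting) diff_add_cancel)
  fix h assume h: "(\<forall>d. d \<notin> D \<longrightarrow> h d = 0) \<and>
    (\<forall>d\<in>D. h d + (\<Sum>d'\<in>{d' \<in> D. d' < d}. h d' * c d' d) = b d)"
  have "h d = ?s d" for d
  proof (induction d rule: less_induct)
    case (less d)
    hence "(\<Sum>d'\<in>{d' \<in> D. d' < d}. h d' * c d' d) = (\<Sum>d'\<in>{d' \<in> D. d' < d}. ?s d' * c d' d)"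
      by (intro sum.cong) auto
    thus ?case using h s1[of d] s2[of d] by (metis (no_types, lifting) eq_diff_eq)
  qed
  thus "h = ?s" by blast
qed

text \<open>\<open>between \<Gamma> (\<nu> + \<gamma>) \<delta>\<close> is the part of
  \<open>above \<Gamma> (\<nu> + \<gamma>)\<close> below \<delta>, so the definite description in
  \<open>eta\<close> is an instance of \<open>unitriangular_ex1\<close>.\<close>

lemma eta_eqs:
  shows "\<delta> \<notin> above \<Gamma> (\<nu> + \<gamma>) \<Longrightarrow> (eta m \<Gamma> a \<nu> \<gamma> \<delta> :: 'k::field mpoly) = 0"
    and "\<delta> \<in> above \<Gamma> (\<nu> + \<gamma>) \<Longrightarrow>
      (eta m \<Gamma> a \<nu> \<gamma> \<delta> :: 'k mpoly) = poly.coeff (gen_f m \<Gamma> \<nu> * fpow m \<Gamma> (a \<gamma>) - fpow m \<Gamma> (a (\<nu> + \<gamma>))) \<delta> -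
        (\<Sum>\<delta>'\<in>between \<Gamma> (\<nu> + \<gamma>) \<delta>. eta m \<Gamma> a \<nu> \<gamma> \<delta>' * poly.coeff (fpow m \<Gamma> (a \<delta>')) \<delta>)"
proof -
  have D: "between \<Gamma> (\<nu> + \<gamma>) \<delta> = {\<delta>' \<in> above \<Gamma> (\<nu> + \<gamma>). \<delta>' < \<delta>}" for \<delta>
    by (auto simp: between_def above_def)
  note eta = theI'[OF unitriangular_ex1, of "above \<Gamma> (\<nu> + \<gamma>)" "\<lambda>\<delta>'. poly.coeff (fpow m \<Gamma> (a \<delta>') :: 'k mpoly poly)"
    "poly.coeff (gen_f m \<Gamma> \<nu> * fpow m \<Gamma> (a \<gamma>) - fpow m \<Gamma> (a (\<nu> + \<gamma>)))",
    folded D, folded eta_def]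
  show "\<delta> \<notin> above \<Gamma> (\<nu> + \<gamma>) \<Longrightarrow> (eta m \<Gamma> a \<nu> \<gamma> \<delta> :: 'k::field mpoly) = 0"
    using eta by blast
  show "\<delta> \<in> above \<Gamma> (\<nu> + \<gamma>) \<Longrightarrow>
      (eta m \<Gamma> a \<nu> \<gamma> \<delta> :: 'k mpoly) = poly.coeff (gen_f m \<Gamma> \<nu> * fpow m \<Gamma> (a \<gamma>) - fpow m \<Gamma> (a (\<nu> + \<gamma>))) \<delta> -
        (\<Sum>\<delta>'\<in>between \<Gamma> (\<nu> + \<gamma>) \<delta>. eta m \<Gamma> a \<nu> \<gamma> \<delta>' * poly.coeff (fpow m \<Gamma> (a \<delta>')) \<delta>)"
    using eta by (metis (no_types, lifting) eq_diff_eq)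
qed

section \<open>Closure properties of P(m, \<Gamma>) inside the type of all polynomials\<close>

lemma PP_simps:
  "p \<in> carrier (PP m \<Gamma>) \<longleftrightarrow> (\<forall>t\<in>Poly_Mapping.keys p. Poly_Mapping.keys t \<subseteq> Idx m \<Gamma>)"
  "x \<otimes>\<^bsub>PP m \<Gamma>\<^esub> y = x * y" "x \<oplus>\<^bsub>PP m \<Gamma>\<^esub> y = x + y" "\<one>\<^bsub>PP m \<Gamma>\<^esub> = 1" "\<zero>\<^bsub>PP m \<Gamma>\<^esub> = 0"
  by (simp_all add: PP_def)

lemma PP_closed:
  shows PP_single: "Poly_Mapping.keys t \<subseteq> Idx m \<Gamma> \<Longrightarrow> Poly_Mapping.single t c \<in> carrier (PP m \<Gamma>)"
    and PP_0: "0 \<in> carrier (PP m \<Gamma>)"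
    and PP_1: "1 \<in> carrier (PP m \<Gamma>)"
    and PP_add: "p \<in> carrier (PP m \<Gamma>) \<Longrightarrow> q \<in> carrier (PP m \<Gamma>) \<Longrightarrow> p + q \<in> carrier (PP m \<Gamma>)"
    and PP_uminus: "p \<in> carrier (PP m \<Gamma>) \<Longrightarrow> - p \<in> carrier (PP m \<Gamma>)"
    and PP_mult: "p \<in> carrier (PP m \<Gamma>) \<Longrightarrow> q \<in> carrier (PP m \<Gamma>) \<Longrightarrow> p * q \<in> carrier (PP m \<Gamma>)"
proof -
  show "Poly_Mapping.keys t \<subseteq> Idx m \<Gamma> \<Longrightarrow> Poly_Mapping.single t c \<in> carrier (PP m \<Gamma>)"
    by (auto simp: PP_simps split: if_splits)
  show "0 \<in> carrier (PP m \<Gamma>)" "1 \<in> carrier (PP m \<Gamma>)" by (auto simp: PP_simps)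
  show "p \<in> carrier (PP m \<Gamma>) \<Longrightarrow> q \<in> carrier (PP m \<Gamma>) \<Longrightarrow> p + q \<in> carrier (PP m \<Gamma>)"
    using Poly_Mapping.keys_add[of p q] by (auto simp: PP_simps)
  show "p \<in> carrier (PP m \<Gamma>) \<Longrightarrow> - p \<in> carrier (PP m \<Gamma>)"
    by (auto simp: PP_simps in_keys_iff)
  show "p * q \<in> carrier (PP m \<Gamma>)" if "p \<in> carrier (PP m \<Gamma>)" "q \<in> carrier (PP m \<Gamma>)"
    unfolding PP_simps(1)
  proof
    fix t assume "t \<in> Poly_Mapping.keys (p * q)"
    then obtain u w where t: "t = u + w" "u \<in> Poly_Mapping.keys p" "w \<in> Poly_Mapping.keys q"
      using Poly_Mapping.keys_mult[of p q] by blast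
    thus "Poly_Mapping.keys t \<subseteq> Idx m \<Gamma>"
      using Poly_Mapping.keys_add[of u w] that unfolding PP_simps(1) by blast
  qed
qed

lemma PP_diff: "p \<in> carrier (PP m \<Gamma>) \<Longrightarrow> q \<in> carrier (PP m \<Gamma>) \<Longrightarrow> p - q \<in> carrier (PP m \<Gamma>)"
  using PP_add[of p m \<Gamma> "- q"] PP_uminus[of q] by simp

lemma PP_sum: "(\<And>i. i \<in> S \<Longrightarrow> p i \<in> carrier (PP m \<Gamma>)) \<Longrightarrow> sum p S \<in> carrier (PP m \<Gamma>)"
  by (induction S rule: infinite_finite_induct) (auto simp: PP_0 PP_add)

lemma PP_cring: "cring (PP m \<Gamma>)"
proof (rule cringI)
  show "abelian_group (PP m \<Gamma>)"
  proof (rule abelian_groupI)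
    fix x assume "x \<in> carrier (PP m \<Gamma>)"
    thus "\<exists>y\<in>carrier (PP m \<Gamma>). y \<oplus>\<^bsub>PP m \<Gamma>\<^esub> x = \<zero>\<^bsub>PP m \<Gamma>\<^esub>"
      by (intro bexI[of _ "- x"]) (auto simp: PP_simps(2-) PP_uminus)
  qed (auto simp: PP_simps(2-) PP_add PP_0 algebra_simps)
  show "comm_monoid (PP m \<Gamma>)"
    by (rule comm_monoidI) (auto simp: PP_simps(2-) PP_mult PP_1 algebra_simps)
qed (auto simp: PP_simps(2-) algebra_simps)

definition coeffs_in :: "nat \<Rightarrow> nat set \<Rightarrow> 'k::field mpoly poly \<Rightarrow> bool" where
  "coeffs_in m \<Gamma> p \<longleftrightarrow> (\<forall>j. poly.coeff p j \<in> carrier (PP m \<Gamma>))"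

lemma coeffs_in_mult: "coeffs_in m \<Gamma> p \<Longrightarrow> coeffs_in m \<Gamma> q \<Longrightarrow> coeffs_in m \<Gamma> (p * q)"
  by (auto simp: coeffs_in_def coeff_mult intro!: PP_sum PP_mult)

lemma coeffs_in_diff: "coeffs_in m \<Gamma> p \<Longrightarrow> coeffs_in m \<Gamma> q \<Longrightarrow> coeffs_in m \<Gamma> (p - q)"
  by (auto simp: coeffs_in_def intro!: PP_diff)

lemma coeffs_in_1: "coeffs_in m \<Gamma> 1"
  by (auto simp: coeffs_in_def coeff_1 PP_0 PP_1)

lemma coeffs_in_power: "coeffs_in m \<Gamma> p \<Longrightarrow> coeffs_in m \<Gamma> (p ^ k)"
  by (induction k) (auto simp: coeffs_in_1 coeffs_in_mult)

lemma coeffs_in_prod: "(\<And>i. i \<in> S \<Longrightarrow> coeffs_in m \<Gamma> (p i)) \<Longrightarrow> coeffs_in m \<Gamma> (prod p S)"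
  by (induction S rule: infinite_finite_induct) (auto simp: coeffs_in_1 coeffs_in_mult)

lemma finite_CC [simp]: "finite (CC m \<Gamma> k)"
  by (rule finite_subset[of _ "{..m}"]) (auto simp: CC_def)

lemma coeff_gen_f:
  "poly.coeff (gen_f m \<Gamma> \<nu>) j = (if j = \<nu> then 1 else if j \<in> CC m \<Gamma> \<nu> then lam \<nu> j else 0)"
proof -
  have "\<nu> \<notin> CC m \<Gamma> \<nu>" by (simp add: CC_def)
  thus ?thesis by (auto simp: gen_f_def coeff_sum)
qed

lemma lead_at_gen_f: "lead_at \<nu> (gen_f m \<Gamma> \<nu>)"
  by (auto simp: lead_at_def coeff_gen_f CC_def)

lemma lam_PP: "\<nu> \<in> ind \<Gamma> \<Longrightarrow> j \<in> CC m \<Gamma> \<nu> \<Longrightarrow> lam \<nu> j \<in> carrier (PP m \<Gamma>)"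
  unfolding lam_def by (rule PP_single) (auto simp: Idx_def)

lemma coeffs_in_gen_f: "\<nu> \<in> ind \<Gamma> \<Longrightarrow> coeffs_in m \<Gamma> (gen_f m \<Gamma> \<nu>)"
  by (auto simp: coeffs_in_def coeff_gen_f PP_0 PP_1 lam_PP)

lemma coeffs_in_fpow: "coeffs_in m \<Gamma> (fpow m \<Gamma> b)"
  unfolding fpow_def by (intro coeffs_in_prod coeffs_in_power coeffs_in_gen_f)

lemma lead_at_fpow: "b \<in> Rel \<Gamma> \<gamma> \<Longrightarrow> lead_at \<gamma> (fpow m \<Gamma> b)"
  unfolding fpow_def Rel_def using lead_at_prod[of "ind \<Gamma>" "\<lambda>\<nu>. b \<nu> * \<nu>" "\<lambda>\<nu>. gen_f m \<Gamma> \<nu> ^ b \<nu>"]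
  by (auto simp: lead_at_power lead_at_gen_f)

text \<open>Solving the system by forward substitution needs sums and products but no division, so
  strong induction on \<delta> never leaves P(m, \<Gamma>).\<close>

lemma eta_PP: "\<nu> \<in> ind \<Gamma> \<Longrightarrow> (eta m \<Gamma> a \<nu> \<gamma> \<delta> :: 'k::field mpoly) \<in> carrier (PP m \<Gamma>)"
proof (induction \<delta> rule: less_induct)
  case (less \<delta>)
  have 1: "coeffs_in m \<Gamma> ((gen_f m \<Gamma> \<nu> :: 'k mpoly poly) * fpow m \<Gamma> (a \<gamma>) - fpow m \<Gamma> (a (\<nu> + \<gamma>)))"
    by (intro coeffs_in_diff coeffs_in_mult coeffs_in_gen_f coeffs_in_fpow less)
  show ?case
  proof (cases "\<delta> \<in> above \<Gamma> (\<nu> + \<gamma>)")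
    case False
    thus ?thesis by (simp add: eta_eqs PP_0)
  next
    case True
    have "(eta m \<Gamma> a \<nu> \<gamma> \<delta>' :: 'k mpoly) * poly.coeff (fpow m \<Gamma> (a \<delta>')) \<delta> \<in> carrier (PP m \<Gamma>)"
      if "\<delta>' \<in> between \<Gamma> (\<nu> + \<gamma>) \<delta>" for \<delta>'
      using that less coeffs_in_fpow[of m \<Gamma> "a \<delta>'"]
      by (intro PP_mult) (auto simp: between_def coeffs_in_def)
    thus ?thesis using 1 unfolding eta_eqs(2)[OF True] coeffs_in_def by (intro PP_diff PP_sum) blast+
  qed
qed

lemma coeffs_in_relpoly: "\<nu> \<in> ind \<Gamma> \<Longrightarrow> coeffs_in m \<Gamma> (relpoly m \<Gamma> a \<nu> \<gamma>)"
  unfolding relpoly_def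
  using coeffs_in_fpow
  by (intro coeffs_in_diff coeffs_in_mult coeffs_in_gen_f coeffs_in_fpow)
    (auto simp: coeffs_in_def coeff_sum eta_PP intro!: PP_sum PP_mult)

lemma relations_subset: "relations m \<Gamma> a \<subseteq> carrier (PP m \<Gamma>)"
  by (auto simp: relations_def rel_index_def intro: coeffs_in_relpoly[unfolded coeffs_in_def, rule_format])

section \<open>Products of generators and vanishing coefficients of the relation polynomials\<close>

lemma unit_vec_Rel:
  assumes "finite (ind \<Gamma>)" "\<nu> \<in> ind \<Gamma>"
  shows "unit_vec \<nu> \<in> Rel \<Gamma> \<nu>"
proof -
  have "(\<Sum>\<mu>\<in>ind \<Gamma>. unit_vec \<nu> \<mu> * \<mu>) = (\<Sum>\<mu>\<in>ind \<Gamma>. if \<mu> = \<nu> then \<nu> else 0)"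
    by (intro sum.cong) (auto simp: unit_vec_def)
  thus ?thesis using assms by (auto simp: Rel_def unit_vec_def)
qed

lemma fpow_unit_vec:
  assumes "finite (ind \<Gamma>)" "\<nu> \<in> ind \<Gamma>"
  shows "fpow m \<Gamma> (unit_vec \<nu>) = gen_f m \<Gamma> \<nu>"
proof -
  have "fpow m \<Gamma> (unit_vec \<nu>) = (\<Prod>\<mu>\<in>ind \<Gamma>. if \<mu> = \<nu> then gen_f m \<Gamma> \<nu> else 1)"
    unfolding fpow_def by (intro prod.cong) (auto simp: unit_vec_def)
  thus ?thesis using assms by auto
qed

text \<open>M is any multiplicatively closed set. Later it consists of the polynomials whose
  evaluation lies in a given point, or of those whose evaluation multiplies \<open>V\<close> into
  itself.\<close>

lemma fpow_mem:
  assumes "1 \<in> M" "\<And>p q. p \<in> M \<Longrightarrow> q \<in> M \<Longrightarrow> p * q \<in> M" "\<And>\<nu>. \<nu> \<in> ind \<Gamma> \<Longrightarrow> gen_f m \<Gamma> \<nu> \<in> M"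
  shows "fpow m \<Gamma> b \<in> M"
proof -
  have pow: "p ^ k \<in> M" if "p \<in> M" for p k
    by (induction k) (use that assms in auto)
  have "(\<Prod>\<nu>\<in>S. gen_f m \<Gamma> \<nu> ^ b \<nu>) \<in> M" if "S \<subseteq> ind \<Gamma>" for S
    using that by (induction S rule: infinite_finite_induct) (auto intro: assms pow)
  thus ?thesis unfolding fpow_def by blast
qed

lemma fpow_add: "fpow m \<Gamma> (\<lambda>\<mu>. b \<mu> + c \<mu>) = fpow m \<Gamma> b * fpow m \<Gamma> c"
  by (simp add: fpow_def power_add prod.distrib)

text \<open>Up to \<nu> + \<gamma> the two products cancel, both starting with x^(\<nu> + \<gamma>),
  and each subtracted f^a(\<delta>) starts later. For larger j in \<Gamma> the claim is the equation
  that defines \<open>eta\<close> at j.\<close>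

lemma coeff_relpoly_0:
  fixes a :: "nat \<Rightarrow> nat \<Rightarrow> nat"
  assumes "finite \<Gamma>" "\<And>\<gamma>. \<gamma> \<in> \<Gamma> \<Longrightarrow> a \<gamma> \<in> Rel \<Gamma> \<gamma>" "\<gamma> \<in> \<Gamma>" "\<nu> + \<gamma> \<in> \<Gamma>"
    "j \<le> \<nu> + \<gamma> \<or> j \<in> \<Gamma>"
  shows "poly.coeff (relpoly m \<Gamma> a \<nu> \<gamma> :: 'k::field mpoly poly) j = 0"
proof -
  let ?f = "\<lambda>\<delta>. fpow m \<Gamma> (a \<delta>) :: 'k mpoly poly" and ?e = "eta m \<Gamma> a \<nu> \<gamma> :: nat \<Rightarrow> 'k mpoly"
  let ?p = "gen_f m \<Gamma> \<nu> * ?f \<gamma> - ?f (\<nu> + \<gamma>)" and ?D = "above \<Gamma> (\<nu> + \<gamma>)"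
  have f: "\<delta> \<in> \<Gamma> \<Longrightarrow> lead_at \<delta> (?f \<delta>)" for \<delta> using assms(2) by (intro lead_at_fpow)
  have lead: "lead_at (\<nu> + \<gamma>) (gen_f m \<Gamma> \<nu> * ?f \<gamma>)" "lead_at (\<nu> + \<gamma>) (?f (\<nu> + \<gamma>))"
    using assms by (auto intro!: lead_at_mult lead_at_gen_f f)
  have eq: "poly.coeff (relpoly m \<Gamma> a \<nu> \<gamma>) j = poly.coeff ?p j - (\<Sum>\<delta>\<in>?D. ?e \<delta> * poly.coeff (?f \<delta>) j)"
    by (simp add: relpoly_def coeff_sum)
  have fin: "finite ?D" using assms(1) by (simp add: above_def)
  show ?thesis
  proof (cases "j \<le> \<nu> + \<gamma>")
    case True
    have "poly.coeff ?p j = 0" using lead True by (cases "j = \<nu> + \<gamma>") (auto simp: lead_at_def)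
    moreover have "poly.coeff (?f \<delta>) j = 0" if "\<delta> \<in> ?D" for \<delta>
      using f[of \<delta>] that True by (auto simp: lead_at_def above_def)
    ultimately show ?thesis unfolding eq by simp
  next
    case False
    hence j: "j \<in> ?D" using assms(5) by (auto simp: above_def)
    \<comment> \<open>Summands with \<delta> > j vanish because f^a(\<delta>) starts with
      x^\<delta>; the summand \<delta> = j is split off below and has coefficient 1.\<close>
    have "(\<Sum>\<delta>\<in>?D. ?e \<delta> * poly.coeff (?f \<delta>) j) = (\<Sum>\<delta>\<in>insert j (between \<Gamma> (\<nu> + \<gamma>) j). ?e \<delta> * poly.coeff (?f \<delta>) j)"
    proof (rule sum.mono_neutral_right[OF fin])
      show "\<forall>\<delta>\<in>?D - insert j (between \<Gamma> (\<nu> + \<gamma>) j). ?e \<delta> * poly.coeff (?f \<delta>) j = 0"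
      proof
        fix \<delta> assume "\<delta> \<in> ?D - insert j (between \<Gamma> (\<nu> + \<gamma>) j)"
        hence "\<delta> \<in> \<Gamma>" "j < \<delta>" by (auto simp: above_def between_def)
        thus "?e \<delta> * poly.coeff (?f \<delta>) j = 0" using f[of \<delta>] by (simp add: lead_at_def)
      qed
    qed (use j in \<open>auto simp: above_def between_def\<close>)
    also have "\<dots> = ?e j + (\<Sum>\<delta>\<in>between \<Gamma> (\<nu> + \<gamma>) j. ?e \<delta> * poly.coeff (?f \<delta>) j)"
      using f[of j] j assms(1) by (subst sum.insert) (auto simp: above_def between_def lead_at_def)
    finally show ?thesis unfolding eq eta_eqs(2)[OF j] by simp
  qed
qed

section \<open>Graded submodules of \<open>R[x]\<close>\<close>

context UP_cring
begin

section \<open>Coefficient functions and the filtration by powers of x\<close>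

lemma UP_carrier_iff: "p \<in> carrier P \<longleftrightarrow> p \<in> up R"
  unfolding P_def UP_def by simp

lemma UP_apply:
  shows "p \<in> carrier P \<Longrightarrow> p n \<in> carrier R"
    and "p \<in> carrier P \<Longrightarrow> q \<in> carrier P \<Longrightarrow> (p \<oplus>\<^bsub>P\<^esub> q) n = p n \<oplus> q n"
    and "c \<in> carrier R \<Longrightarrow> p \<in> carrier P \<Longrightarrow> (c \<odot>\<^bsub>P\<^esub> p) n = c \<otimes> p n"
    and "p \<in> carrier P \<Longrightarrow> q \<in> carrier P \<Longrightarrow> (p \<otimes>\<^bsub>P\<^esub> q) n = (\<Oplus>i\<in>{..n}. p i \<otimes> q (n - i))"
    and "\<one>\<^bsub>P\<^esub> n = (if n = 0 then \<one> else \<zero>)"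
    and "\<zero>\<^bsub>P\<^esub> n = \<zero>"
proof -
  have cf: "p \<in> carrier P \<Longrightarrow> up_ring.coeff P p n = p n" for p n
    unfolding UP_carrier_iff unfolding P_def UP_def by simp
  show "p \<in> carrier P \<Longrightarrow> p n \<in> carrier R"
    unfolding UP_carrier_iff by (rule mem_upD)
  show "p \<in> carrier P \<Longrightarrow> q \<in> carrier P \<Longrightarrow> (p \<oplus>\<^bsub>P\<^esub> q) n = p n \<oplus> q n"
    using coeff_add[of p q n] by (simp add: cf)
  show "c \<in> carrier R \<Longrightarrow> p \<in> carrier P \<Longrightarrow> (c \<odot>\<^bsub>P\<^esub> p) n = c \<otimes> p n"
    using coeff_smult[of c p n] by (simp add: cf)
  show "p \<in> carrier P \<Longrightarrow> q \<in> carrier P \<Longrightarrow> (p \<otimes>\<^bsub>P\<^esub> q) n = (\<Oplus>i\<in>{..n}. p i \<otimes> q (n - i))"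
    using coeff_mult[of p q n] by (simp add: cf)
  show "\<one>\<^bsub>P\<^esub> n = (if n = 0 then \<one> else \<zero>)"
    using coeff_one[of n] unfolding cf[OF UP_one_closed] .
  show "\<zero>\<^bsub>P\<^esub> n = \<zero>"
    using coeff_zero[of n] unfolding cf[OF UP_zero_closed] .
qed

text \<open>This is the ideal generated by x^n; \<open>Fil_eq_monom_mult\<close> proves the
  identification.\<close>

definition Fil :: "nat \<Rightarrow> (nat \<Rightarrow> 'a) set" where
  "Fil n = {p \<in> carrier P. \<forall>j<n. p j = \<zero>}"

lemma Fil_carrier: "p \<in> Fil n \<Longrightarrow> p \<in> carrier P"
  by (simp add: Fil_def)

lemma Fil_0: "Fil 0 = carrier P"
  by (simp add: Fil_def)

lemma zero_Fil: "\<zero>\<^bsub>P\<^esub> \<in> Fil n"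
  by (simp add: Fil_def UP_apply)

lemma Fil_add: "p \<in> Fil n \<Longrightarrow> q \<in> Fil n \<Longrightarrow> p \<oplus>\<^bsub>P\<^esub> q \<in> Fil n"
  by (simp add: Fil_def UP_apply)

lemma Fil_smult: "c \<in> carrier R \<Longrightarrow> p \<in> Fil n \<Longrightarrow> c \<odot>\<^bsub>P\<^esub> p \<in> Fil n"
  by (simp add: Fil_def UP_apply)

lemma Fil_mono: "p \<in> Fil n \<Longrightarrow> k \<le> n \<Longrightarrow> p \<in> Fil k"
  by (simp add: Fil_def)

lemma Fil_Suc: "p \<in> Fil (Suc n) \<longleftrightarrow> p \<in> Fil n \<and> p n = \<zero>"
  by (auto simp: Fil_def less_Suc_eq)

lemma Fil_mult:
  assumes "p \<in> Fil k" "q \<in> Fil l"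
  shows "p \<otimes>\<^bsub>P\<^esub> q \<in> Fil (k + l)"
proof -
  have "(\<Oplus>i\<in>{..n}. p i \<otimes> q (n - i)) = \<zero>" if n: "n < k + l" for n
  proof (rule R.add.finprod_one_eqI)
    fix i assume "i \<in> {..n}"
    hence "i < k \<or> n - i < l" using n by auto
    thus "p i \<otimes> q (n - i) = \<zero>"
      using assms UP_apply(1) by (auto simp: Fil_def)
  qed
  thus ?thesis using assms by (simp add: Fil_def UP_apply)
qed

text \<open>Dividing by x^m shifts the coefficients down by m, and a bound for p also bounds the
  shifted sequence.\<close>

lemma Fil_eq_monom_mult: "Fil m = (\<lambda>g. up_ring.monom P \<one> m \<otimes>\<^bsub>P\<^esub> g) ` carrier P"
proof -
  let ?x = "up_ring.monom P \<one> m"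
  have x: "?x i = (if i = m then \<one> else \<zero>)" for i
    unfolding P_def UP_def by simp
  have xP: "?x \<in> carrier P" by simp
  hence xF: "?x \<in> Fil m" by (simp add: Fil_def x)
  show ?thesis
  proof
    show "(\<lambda>g. ?x \<otimes>\<^bsub>P\<^esub> g) ` carrier P \<subseteq> Fil m"
      using Fil_mult[OF xF, of _ 0] by (auto simp: Fil_0)
    show "Fil m \<subseteq> (\<lambda>g. ?x \<otimes>\<^bsub>P\<^esub> g) ` carrier P"
    proof
      fix p assume p: "p \<in> Fil m"
      define g where "g = (\<lambda>n. p (n + m))"
      have "p \<in> up R" using p by (simp add: Fil_def UP_carrier_iff)
      then obtain b where b: "bound \<zero> b p" by blast
      have "bound \<zero> b g" using b by (auto simp: g_def bound_def)
      hence g: "g \<in> carrier P" using \<open>p \<in> up R\<close> by (auto simp: UP_carrier_iff up_def g_def)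
      have "(?x \<otimes>\<^bsub>P\<^esub> g) n = p n" for n
      proof (cases "n < m")
        case True
        thus ?thesis using p Fil_mult[OF xF, of g 0] g by (auto simp: Fil_0 Fil_def)
      next
        case False
        have "(?x \<otimes>\<^bsub>P\<^esub> g) n = (\<Oplus>i\<in>{..n}. if m = i then g (n - i) else \<zero>)"
          unfolding UP_apply(4)[OF xP g] x
          by (rule R.finsum_cong') (auto simp: g UP_apply(1))
        also have "\<dots> = g (n - m)"
          using False by (intro R.finsum_singleton) (auto simp: g UP_apply(1))
        finally show ?thesis using False by (simp add: g_def)
      qed
      thus "p \<in> (\<lambda>g. ?x \<otimes>\<^bsub>P\<^esub> g) ` carrier P" using g by (intro image_eqI[of _ _ g]) auto
    qed
  qed
qed

text \<open>For n < m, the ideal of coefficients at x^n of the elements of A that start no earlier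
  than n is all of R if n lies in D, and 0 otherwise. This is the shape of a point with the
  multiplication left out.\<close>

definition graded_submodule :: "nat set \<Rightarrow> nat \<Rightarrow> (nat \<Rightarrow> 'a) set \<Rightarrow> bool" where
  "graded_submodule D m A \<longleftrightarrow> A \<subseteq> carrier P \<and> Fil m \<subseteq> A \<and>
     (\<forall>p\<in>A. \<forall>q\<in>A. p \<oplus>\<^bsub>P\<^esub> q \<in> A) \<and> (\<forall>c\<in>carrier R. \<forall>p\<in>A. c \<odot>\<^bsub>P\<^esub> p \<in> A) \<and>
     (\<forall>n\<in>D. \<exists>f\<in>A. f \<in> Fil n \<and> f n = \<one>) \<and>
     (\<forall>n<m. n \<notin> D \<longrightarrow> (\<forall>f\<in>A. f \<in> Fil n \<longrightarrow> f n = \<zero>))"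

text \<open>The order of p is pushed up one index at a time: indices in D are covered by the
  hypothesis on p, the others by the gaps of A.\<close>

lemma graded_submodule_vanish:
  assumes "graded_submodule D m A" "p \<in> A" "\<And>n. n \<in> D \<Longrightarrow> p n = \<zero>"
  shows "p \<in> Fil m"
proof -
  have "n \<le> m \<Longrightarrow> p \<in> Fil n" for n
  proof (induction n)
    case 0
    thus ?case using assms by (auto simp: Fil_0 graded_submodule_def)
  next
    case (Suc n)
    thus ?case using assms by (cases "n \<in> D") (auto simp: Fil_Suc graded_submodule_def)
  qed
  thus ?thesis by simp
qed

text \<open>Echelon reduction: for each k in D above n, a multiple of an element of A starting with
  x^k clears the coefficient at k and leaves all lower ones alone.\<close>

lemma graded_submodule_reduce:
  assumes A: "graded_submodule D m A" and "n \<le> m" "p \<in> A" "p \<in> Fil n"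
  shows "\<exists>q\<in>A. (\<forall>j\<le>n. q j = p j) \<and> q \<in> Fil n \<and> (\<forall>j\<in>D. n < j \<and> j < m \<longrightarrow> q j = \<zero>)"
proof -
  have "k \<le> m \<Longrightarrow> \<exists>q\<in>A. (\<forall>j\<le>n. q j = p j) \<and> q \<in> Fil n \<and> (\<forall>j\<in>D. n < j \<and> j < k \<longrightarrow> q j = \<zero>)" for k
  proof (induction k)
    case 0
    thus ?case using assms by auto
  next
    case (Suc k)
    then obtain q where q: "q \<in> A" "\<forall>j\<le>n. q j = p j" "q \<in> Fil n"
      "\<forall>j\<in>D. n < j \<and> j < k \<longrightarrow> q j = \<zero>" by auto
    show ?case
    proof (cases "k \<in> D \<and> n < k")
      case False
      thus ?thesis using q by (auto intro!: bexI[of _ q] simp: less_Suc_eq)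
    next
      case True
      then obtain f where f: "f \<in> A" "f \<in> Fil k" "f k = \<one>"
        using A by (auto simp: graded_submodule_def)
      have c: "f \<in> carrier P" "q \<in> carrier P" "\<And>j. q j \<in> carrier R"
        using f q Fil_carrier UP_apply(1) by blast+
      define r where "r = q \<oplus>\<^bsub>P\<^esub> (\<ominus> q k) \<odot>\<^bsub>P\<^esub> f"
      have "r j = q j \<oplus> (\<ominus> q k) \<otimes> f j" for j
        using c by (simp add: r_def UP_apply)
      hence 1: "r j = q j" if "j < k" for j using that f(2) c by (simp add: Fil_def)
      have 2: "r k = \<zero>" using \<open>\<And>j. r j = _ j\<close> c f by (simp add: R.r_neg)
      have "r \<in> A" using A q f c by (simp add: graded_submodule_def r_def)
      moreover have "\<forall>j\<le>n. r j = p j" using 1 True q by auto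
      moreover have "r \<in> Fil n" using c 1 True q by (auto simp: Fil_def r_def)
      moreover have "\<forall>j\<in>D. n < j \<and> j < Suc k \<longrightarrow> r j = \<zero>"
        using 1 2 q by (auto simp: less_Suc_eq)
      ultimately show ?thesis by blast
    qed
  qed
  thus ?thesis by simp
qed

text \<open>Existence comes from reducing and truncating at m. For uniqueness, the difference of two
  candidates vanishes on D, hence lies in \<open>Fil m\<close>, and both candidates vanish from m
  on.\<close>

lemma graded_submodule_canonical:
  assumes A: "graded_submodule D m A" and D: "D \<subseteq> {..<m}" "n \<in> D"
  shows "\<exists>!f. f \<in> A \<and> f n = \<one> \<and> (\<forall>j. j \<noteq> n \<longrightarrow> \<not> (j \<notin> D \<and> n < j \<and> j < m) \<longrightarrow> f j = \<zero>)"
proof -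
  have nm: "n < m" using D by auto
  obtain g where g: "g \<in> A" "g \<in> Fil n" "g n = \<one>"
    using A D by (auto simp: graded_submodule_def)
  obtain q where q: "q \<in> A" "q n = \<one>" "q \<in> Fil n" "\<forall>j\<in>D. n < j \<and> j < m \<longrightarrow> q j = \<zero>"
    using graded_submodule_reduce[OF A _ g(1,2)] nm g(3) by auto
  have qc: "q \<in> carrier P" "\<And>j. q j \<in> carrier R"
    using q UP_apply(1) Fil_carrier by blast+
  \<comment> \<open>Adding r truncates q at m without leaving A, because A contains
    \<open>Fil m\<close>.\<close>
  define r where "r = (\<lambda>j. if j < m then \<zero> else \<ominus> q j)"
  have "r \<in> carrier P"
  proof -
    have "q \<in> up R" using qc by (simp add: UP_carrier_iff)
    then obtain b where b: "bound \<zero> b q" by blast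
    have "bound \<zero> b r" using b by (auto simp: r_def bound_def)
    thus ?thesis using qc by (auto simp: UP_carrier_iff up_def r_def)
  qed
  hence r: "r \<in> Fil m" by (auto simp: Fil_def r_def)
  define f where "f = q \<oplus>\<^bsub>P\<^esub> r"
  have f: "f j = (if j < m then q j else \<zero>)" for j
    using qc \<open>r \<in> carrier P\<close> by (simp add: f_def UP_apply) (simp add: r_def R.r_neg UP_apply(1))
  have fA: "f \<in> A" using A q r by (auto simp: graded_submodule_def f_def)
  show ?thesis
  proof (rule ex1I)
    show "f \<in> A \<and> f n = \<one> \<and> (\<forall>j. j \<noteq> n \<longrightarrow> \<not> (j \<notin> D \<and> n < j \<and> j < m) \<longrightarrow> f j = \<zero>)"
      using fA nm q by (auto simp: f Fil_def) (metis nat_neq_iff)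
  next
    fix h assume h: "h \<in> A \<and> h n = \<one> \<and> (\<forall>j. j \<noteq> n \<longrightarrow> \<not> (j \<notin> D \<and> n < j \<and> j < m) \<longrightarrow> h j = \<zero>)"
    have AP: "A \<subseteq> carrier P" using A by (simp add: graded_submodule_def)
    have c: "h \<in> carrier P" "f \<in> carrier P" "\<And>j. f j \<in> carrier R" "\<And>j. h j \<in> carrier R"
      using h fA AP UP_apply(1) by blast+
    define d where "d = h \<oplus>\<^bsub>P\<^esub> (\<ominus> \<one>) \<odot>\<^bsub>P\<^esub> f"
    have d: "d j = h j \<ominus> f j" for j
      using c by (simp add: d_def UP_apply R.l_minus a_minus_def)
    have "d \<in> A" using A h fA by (auto simp: graded_submodule_def d_def)
    moreover have "d j = \<zero>" if "j \<in> D" for j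
    proof (cases "j = n")
      case True
      thus ?thesis using h nm q by (simp add: d f)
    next
      case False
      hence "h j = \<zero>" "f j = \<zero>" using h that q by (auto simp: f Fil_def neq_iff)
      thus ?thesis by (simp add: d)
    qed
    ultimately have dF: "d \<in> Fil m" using graded_submodule_vanish[OF A] by blast
    show "h = f"
    proof
      fix j
      have "d j = \<zero>"
      proof (cases "j < m")
        case True
        thus ?thesis using dF by (simp add: Fil_def)
      next
        case False
        hence "h j = \<zero>" "f j = \<zero>" using h nm by (auto simp: f)
        thus ?thesis by (simp add: d)
      qed
      thus "h j = f j" using d c by simp
    qed
  qed
qed

text \<open>Level n describes the sums of multiples of \<open>g k\<close>, for k in D with n \<le> k
  < m, plus an element of \<open>Fil m\<close>. Peeling off one index at a time suits inductions
  along the triangular shape.\<close>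

inductive span_from ::
  "(nat \<Rightarrow> nat \<Rightarrow> 'a) \<Rightarrow> nat set \<Rightarrow> nat \<Rightarrow> nat \<Rightarrow> (nat \<Rightarrow> 'a) \<Rightarrow> bool" for g D m where
  base: "p \<in> Fil m \<Longrightarrow> span_from g D m m p"
| skip: "n < m \<Longrightarrow> n \<notin> D \<Longrightarrow> span_from g D m (Suc n) p \<Longrightarrow> span_from g D m n p"
| step: "n < m \<Longrightarrow> n \<in> D \<Longrightarrow> c \<in> carrier R \<Longrightarrow> span_from g D m (Suc n) p \<Longrightarrow>
    span_from g D m n (c \<odot>\<^bsub>P\<^esub> g n \<oplus>\<^bsub>P\<^esub> p)"

section \<open>Spans of families with prescribed lowest terms\<close>

context
  fixes g :: "nat \<Rightarrow> nat \<Rightarrow> 'a" and D :: "nat set" and m :: nat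
  assumes D: "D \<subseteq> {..<m}" and g: "\<And>n. n \<in> D \<Longrightarrow> g n \<in> Fil n" "\<And>n. n \<in> D \<Longrightarrow> g n n = \<one>"
begin

lemma span_from_m: "span_from g D m m p \<longleftrightarrow> p \<in> Fil m"
  by (subst span_from.simps) auto

lemma span_from_skip_iff: "n < m \<Longrightarrow> n \<notin> D \<Longrightarrow> span_from g D m n p \<longleftrightarrow> span_from g D m (Suc n) p"
  by (subst span_from.simps) auto

lemma span_from_step_iff: "n \<in> D \<Longrightarrow> span_from g D m n p \<longleftrightarrow>
    (\<exists>c\<in>carrier R. \<exists>q. span_from g D m (Suc n) q \<and> p = c \<odot>\<^bsub>P\<^esub> g n \<oplus>\<^bsub>P\<^esub> q)"
  using D by (subst span_from.simps) auto

lemma g_carrier: "n \<in> D \<Longrightarrow> g n \<in> carrier P"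
  using g(1) Fil_carrier by blast

lemma span_from_Fil: "span_from g D m n p \<Longrightarrow> p \<in> Fil n"
proof (induction n p rule: span_from.induct)
  case (step n c p)
  thus ?case using g by (auto intro!: Fil_add Fil_smult simp: Fil_Suc)
qed (auto simp: Fil_Suc)

lemma span_from_carrier: "span_from g D m n p \<Longrightarrow> p \<in> carrier P"
  using span_from_Fil Fil_carrier by blast

lemma span_from_add_smult:
  "n \<le> m \<Longrightarrow> (\<forall>p q. span_from g D m n p \<longrightarrow> span_from g D m n q \<longrightarrow> span_from g D m n (p \<oplus>\<^bsub>P\<^esub> q)) \<and>
    (\<forall>c\<in>carrier R. \<forall>p. span_from g D m n p \<longrightarrow> span_from g D m n (c \<odot>\<^bsub>P\<^esub> p))"
proof (induction n rule: inc_induct)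
  case base
  show ?case by (auto simp: span_from_m Fil_add Fil_smult)
next
  case (step n)
  show ?case
  proof (cases "n \<in> D")
    case False
    thus ?thesis using step by (simp add: span_from_skip_iff)
  next
    case n: True
    have "span_from g D m n (p \<oplus>\<^bsub>P\<^esub> q)" if "span_from g D m n p" "span_from g D m n q" for p q
    proof -
      obtain c p' d q' where *: "c \<in> carrier R" "d \<in> carrier R" "span_from g D m (Suc n) p'"
        "span_from g D m (Suc n) q'" "p = c \<odot>\<^bsub>P\<^esub> g n \<oplus>\<^bsub>P\<^esub> p'" "q = d \<odot>\<^bsub>P\<^esub> g n \<oplus>\<^bsub>P\<^esub> q'"
        using \<open>span_from g D m n p\<close> \<open>span_from g D m n q\<close> n by (auto simp: span_from_step_iff)
      note c = g_carrier[OF n] span_from_carrier[OF *(3)] span_from_carrier[OF *(4)]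
      have "p \<oplus>\<^bsub>P\<^esub> q = (c \<oplus> d) \<odot>\<^bsub>P\<^esub> g n \<oplus>\<^bsub>P\<^esub> (p' \<oplus>\<^bsub>P\<^esub> q')"
        using * c by (auto simp: UP_smult_l_distr P.a_ac)
      moreover have "span_from g D m (Suc n) (p' \<oplus>\<^bsub>P\<^esub> q')" using step * by blast
      ultimately show ?thesis using n *(1,2) by (auto simp: span_from_step_iff)
    qed
    moreover have "span_from g D m n (d \<odot>\<^bsub>P\<^esub> p)" if "span_from g D m n p" "d \<in> carrier R" for p d
    proof -
      obtain c p' where *: "c \<in> carrier R" "span_from g D m (Suc n) p'" "p = c \<odot>\<^bsub>P\<^esub> g n \<oplus>\<^bsub>P\<^esub> p'"
        using \<open>span_from g D m n p\<close> n by (auto simp: span_from_step_iff)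
      note c = g_carrier[OF n] span_from_carrier[OF *(2)]
      have "d \<odot>\<^bsub>P\<^esub> p = (d \<otimes> c) \<odot>\<^bsub>P\<^esub> g n \<oplus>\<^bsub>P\<^esub> (d \<odot>\<^bsub>P\<^esub> p')"
        using * c that by (simp add: UP_smult_r_distr UP_smult_assoc1)
      moreover have "span_from g D m (Suc n) (d \<odot>\<^bsub>P\<^esub> p')" using step * that by blast
      ultimately show ?thesis using n *(1) that(2) by (auto simp: span_from_step_iff)
    qed
    ultimately show ?thesis by blast
  qed
qed

lemma span_from_le: "n \<le> m \<Longrightarrow> span_from g D m n p \<Longrightarrow> k \<le> n \<Longrightarrow> span_from g D m k p"
proof (rotate_tac 2, induction k rule: inc_induct)
  case (step k)
  have p: "p \<in> carrier P" using step span_from_carrier by blast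
  show ?case
  proof (cases "k \<in> D")
    case True
    \<comment> \<open>Passing down through an index of D costs only the coefficient 0.\<close>
    have "p = \<zero> \<odot>\<^bsub>P\<^esub> g k \<oplus>\<^bsub>P\<^esub> p" using p g_carrier[OF True] by simp
    thus ?thesis using step True by (auto simp: span_from_step_iff)
  qed (use step in \<open>auto simp: span_from_skip_iff\<close>)
qed simp

lemma Fil_span_from: "p \<in> Fil m \<Longrightarrow> n \<le> m \<Longrightarrow> span_from g D m n p"
  using span_from_le[of m p n] by (simp add: span_from_m)

lemma g_span_from:
  assumes "n \<in> D"
  shows "span_from g D m n (g n)"
proof -
  have "g n = \<one> \<odot>\<^bsub>P\<^esub> g n \<oplus>\<^bsub>P\<^esub> \<zero>\<^bsub>P\<^esub>" using g_carrier[OF assms] by simp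
  moreover have "span_from g D m (Suc n) \<zero>\<^bsub>P\<^esub>"
    using assms D by (intro Fil_span_from zero_Fil) auto
  ultimately show ?thesis using assms by (auto simp: span_from_step_iff)
qed

text \<open>Since \<open>g n n\<close> is 1 and the rest starts after n, the coefficient used at n
  equals \<open>p n\<close>. If \<open>p n\<close> vanishes, the summand drops out and p lies one
  level higher.\<close>

lemma span_from_shift:
  "n \<le> m \<Longrightarrow> span_from g D m 0 p \<Longrightarrow> p \<in> Fil n \<Longrightarrow> span_from g D m n p"
proof (induction n)
  case (Suc n)
  hence n: "n < m" "span_from g D m n p" "p n = \<zero>" by (auto simp: Fil_Suc)
  show ?case
  proof (cases "n \<in> D")
    case True
    then obtain c q where *: "c \<in> carrier R" "span_from g D m (Suc n) q" "p = c \<odot>\<^bsub>P\<^esub> g n \<oplus>\<^bsub>P\<^esub> q"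
      using n by (auto simp: span_from_step_iff)
    have q: "q \<in> carrier P" "q n = \<zero>" using span_from_Fil[OF *(2)] by (auto simp: Fil_def)
    have "p n = c" using * q g_carrier[OF True] g(2)[OF True] by (simp add: UP_apply)
    hence "p = q" using * q n g_carrier[OF True] by simp
    thus ?thesis using * by simp
  qed (use n in \<open>auto simp: span_from_skip_iff\<close>)
qed

text \<open>The gap condition is the only part beyond linearity: an element starting at n outside D
  sits at level n by \<open>span_from_shift\<close>, hence at level n + 1, so its coefficient at n
  is 0.\<close>

lemma graded_submodule_span: "graded_submodule D m {p. span_from g D m 0 p}"
proof -
  have "f n = \<zero>" if "n < m" "n \<notin> D" "span_from g D m 0 f" "f \<in> Fil n" for n f
  proof -
    have "span_from g D m (Suc n) f"
      using span_from_shift[of n f] that by (simp add: span_from_skip_iff)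
    thus ?thesis using span_from_Fil[of "Suc n" f] by (simp add: Fil_Suc)
  qed
  moreover have "span_from g D m 0 (g n)" if "n \<in> D" for n
    using span_from_le[OF _ g_span_from[OF that]] that D by auto
  moreover have "p \<in> carrier P" if "span_from g D m 0 p" for p
    using that by (rule span_from_carrier)
  moreover have "span_from g D m 0 p" if "p \<in> Fil m" for p
    using that by (rule Fil_span_from) simp
  moreover have "span_from g D m 0 (p \<oplus>\<^bsub>P\<^esub> q)" if "span_from g D m 0 p" "span_from g D m 0 q" for p q
    using that span_from_add_smult[of 0] by simp
  moreover have "span_from g D m 0 (c \<odot>\<^bsub>P\<^esub> p)" if "c \<in> carrier R" "span_from g D m 0 p" for c p
    using that span_from_add_smult[of 0] by simp
  moreover have "\<exists>f\<in>{p. span_from g D m 0 p}. f \<in> Fil n \<and> f n = \<one>" if "n \<in> D" for n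
    using calculation(2)[OF that] g[OF that] by (intro bexI[of _ "g n"]) auto
  ultimately show ?thesis
    unfolding graded_submodule_def by (intro conjI allI impI ballI subsetI) simp_all
qed

text \<open>Downward induction on n: subtracting \<open>p n\<close> times \<open>g n\<close> raises
  the order of p when n is in D, and otherwise the gap condition raises it. Thus a graded submodule
  is determined by any such family it contains.\<close>

lemma graded_submodule_eq_span:
  assumes A: "graded_submodule D m A" and gA: "\<And>n. n \<in> D \<Longrightarrow> g n \<in> A"
  shows "A = {p. span_from g D m 0 p}"
proof
  have "n \<le> m \<Longrightarrow> span_from g D m n p \<Longrightarrow> p \<in> A" for n p
  proof (rotate_tac, induction n p rule: span_from.induct)
    case (step n c p)
    thus ?case using A gA by (auto simp: graded_submodule_def)
  qed (use A in \<open>auto simp: graded_submodule_def\<close>)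
  thus "{p. span_from g D m 0 p} \<subseteq> A" by auto
next
  have "n \<le> m \<Longrightarrow> \<forall>p\<in>A \<inter> Fil n. span_from g D m n p" for n
  proof (induction n rule: inc_induct)
    case base
    show ?case by (simp add: span_from_m)
  next
    case (step n)
    show ?case
    proof (cases "n \<in> D")
      case False
      thus ?thesis using step A by (auto simp: span_from_skip_iff Fil_Suc graded_submodule_def)
    next
      case n: True
      show ?thesis
      proof
        fix p assume p: "p \<in> A \<inter> Fil n"
        have c: "p \<in> carrier P" "g n \<in> carrier P" "\<And>j. p j \<in> carrier R"
          using p Fil_carrier g_carrier[OF n] UP_apply(1) by blast+
        define q where "q = (\<ominus> p n) \<odot>\<^bsub>P\<^esub> g n \<oplus>\<^bsub>P\<^esub> p"
        have "q \<in> A" using A p gA n c by (auto simp: graded_submodule_def q_def)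
        moreover have "q \<in> Fil n" unfolding q_def using p g(1)[OF n] c
          by (intro Fil_add Fil_smult) auto
        moreover have "q n = \<zero>"
          using c g(2)[OF n] by (simp add: q_def UP_apply R.l_neg)
        ultimately have "span_from g D m (Suc n) q" using step by (auto simp: Fil_Suc)
        moreover have "p = p n \<odot>\<^bsub>P\<^esub> g n \<oplus>\<^bsub>P\<^esub> q"
        proof -
          have "p n \<odot>\<^bsub>P\<^esub> g n \<oplus>\<^bsub>P\<^esub> q = (p n \<oplus> \<ominus> p n) \<odot>\<^bsub>P\<^esub> g n \<oplus>\<^bsub>P\<^esub> p"
            using c by (simp only: UP_smult_l_distr q_def P.a_assoc UP_smult_closed R.a_inv_closed)
          thus ?thesis using c by (simp add: R.r_neg)
        qed
        ultimately show "span_from g D m n p" using n c by (auto simp: span_from_step_iff)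
      qed
    qed
  qed
  from this[of 0] show "A \<subseteq> {p. span_from g D m 0 p}"
    using A by (auto simp: Fil_0 graded_submodule_def)
qed

end

end

section \<open>Evaluation of polynomials\<close>

lemma update_eq_single_add:
  fixes p :: "'x \<Rightarrow>\<^sub>0 'y::comm_monoid_add"
  assumes "t \<notin> Poly_Mapping.keys p"
  shows "Poly_Mapping.update t c p = Poly_Mapping.single t c + p"
  using assms by (intro poly_mapping_eqI)
    (auto simp: lookup_update lookup_add lookup_single in_keys_iff when_def)

lemma poly_mapping_add_induct:
  fixes p :: "'x \<Rightarrow>\<^sub>0 'y::comm_monoid_add"
  assumes "Q 0" "\<And>t c p. Q p \<Longrightarrow> Q (Poly_Mapping.single t c + p)"
  shows "Q p"
  by (induction p rule: update_induct) (simp_all add: assms update_eq_single_add)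

lemma comm_algebra_hom:
  fixes R :: "'r ring" and \<phi> :: "'k::field \<Rightarrow> 'r"
  assumes "comm_algebra R \<phi>"
  shows "\<phi> x \<in> carrier R" "\<phi> (x + y) = \<phi> x \<oplus>\<^bsub>R\<^esub> \<phi> y" "\<phi> (x * y) = \<phi> x \<otimes>\<^bsub>R\<^esub> \<phi> y"
    "\<phi> 1 = \<one>\<^bsub>R\<^esub>" "\<phi> 0 = \<zero>\<^bsub>R\<^esub>"
proof -
  interpret R: cring R using assms by (simp add: comm_algebra_def)
  have h: "\<phi> \<in> ring_hom (ring_of_type_algebra :: 'k ring) R" using assms by (simp add: comm_algebra_def)
  show "\<phi> x \<in> carrier R" "\<phi> (x + y) = \<phi> x \<oplus>\<^bsub>R\<^esub> \<phi> y" "\<phi> (x * y) = \<phi> x \<otimes>\<^bsub>R\<^esub> \<phi> y"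
    "\<phi> 1 = \<one>\<^bsub>R\<^esub>"
    using ring_hom_closed[OF h, of x] ring_hom_add[OF h, of x y] ring_hom_mult[OF h, of x y]
      ring_hom_one[OF h] by (simp_all add: K_simps)
  show "\<phi> 0 = \<zero>\<^bsub>R\<^esub>"
    using ring_hom_zero[OF h ring_from_type_algebra R.ring_axioms] by (simp add: K_simps)
qed

text \<open>The values v i lie in R for every pair i, also outside \<open>Idx m \<Gamma>\<close>, so
  evaluation is a homomorphism on the whole polynomial type and variables need not be
  tracked.\<close>

locale mpoly_point = UP_cring R P for R :: "'r ring" (structure) and P (structure) +
  fixes \<phi> :: "'k::field \<Rightarrow> 'r" and v :: "nat \<times> nat \<Rightarrow> 'r"
  assumes alg: "comm_algebra R \<phi>" and v_closed [simp]: "\<And>i. v i \<in> carrier R"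
begin

lemmas hom = comm_algebra_hom[OF alg]

definition mon :: "(nat \<times> nat \<Rightarrow>\<^sub>0 nat) \<Rightarrow> 'r" where
  "mon t = (\<Otimes>i\<in>Poly_Mapping.keys t. v i [^] Poly_Mapping.lookup t i)"

abbreviation ev :: "'k mpoly \<Rightarrow> 'r" where
  "ev \<equiv> mpoly_eval R \<phi> v"

lemma mon_superset:
  assumes "finite S" "Poly_Mapping.keys t \<subseteq> S"
  shows "mon t = (\<Otimes>i\<in>S. v i [^] Poly_Mapping.lookup t i)"
  unfolding mon_def using assms
  by (intro R.finprod_mono_neutral_cong_left) (auto simp: in_keys_iff)

lemma mon_closed [simp]: "mon t \<in> carrier R"
  unfolding mon_def by (intro R.finprod_closed) auto

lemma mon_add: "mon (t + u) = mon t \<otimes> mon u"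
proof -
  let ?S = "Poly_Mapping.keys t \<union> Poly_Mapping.keys u"
  have "mon (t + u) = (\<Otimes>i\<in>?S. v i [^] Poly_Mapping.lookup t i \<otimes> v i [^] Poly_Mapping.lookup u i)"
    using Poly_Mapping.keys_add[of t u]
    by (subst mon_superset[of ?S]) (auto simp: lookup_add R.nat_pow_mult)
  also have "\<dots> = mon t \<otimes> mon u"
    by (subst R.finprod_multf) (auto simp: mon_superset[of ?S])
  finally show ?thesis .
qed

lemma ev_mon: "ev p = (\<Oplus>t\<in>Poly_Mapping.keys p. \<phi> (Poly_Mapping.lookup p t) \<otimes> mon t)"
  by (simp add: mpoly_eval_def mon_def)

text \<open>Cancellation can make the support of a sum smaller than the union of the supports.
  Comparing over a common finite set avoids this, as the extra summands are 0.\<close>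

lemma ev_superset:
  assumes "finite S" "Poly_Mapping.keys p \<subseteq> S"
  shows "ev p = (\<Oplus>t\<in>S. \<phi> (Poly_Mapping.lookup p t) \<otimes> mon t)"
  unfolding ev_mon using assms
  by (intro R.add.finprod_mono_neutral_cong_left) (auto simp: in_keys_iff hom)

lemma ev_closed [simp]: "ev p \<in> carrier R"
  unfolding ev_mon by (intro R.finsum_closed) (auto simp: hom)

lemma ev_add: "ev (p + q) = ev p \<oplus> ev q"
proof -
  let ?S = "Poly_Mapping.keys p \<union> Poly_Mapping.keys q"
  have "ev (p + q) = (\<Oplus>t\<in>?S. \<phi> (Poly_Mapping.lookup p t) \<otimes> mon t \<oplus> \<phi> (Poly_Mapping.lookup q t) \<otimes> mon t)"
    using Poly_Mapping.keys_add[of p q]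
    by (subst ev_superset[of ?S]) (auto simp: lookup_add hom R.l_distr)
  also have "\<dots> = ev p \<oplus> ev q"
    by (subst R.finsum_addf) (auto simp: ev_superset[of ?S] hom)
  finally show ?thesis .
qed

lemma ev_0 [simp]: "ev 0 = \<zero>"
  by (simp add: ev_mon)

lemma ev_single: "ev (Poly_Mapping.single t c) = \<phi> c \<otimes> mon t"
  by (cases "c = 0") (simp_all add: ev_mon hom)

lemma mon_0: "mon 0 = \<one>"
  by (simp add: mon_def)

lemma ev_1 [simp]: "ev 1 = \<one>"
  using ev_single[of 0 1] by (simp add: hom mon_0)

lemma ev_lam: "ev (lam \<nu> j) = v (\<nu>, j)"
  by (simp add: lam_def ev_single hom mon_def)

lemma ev_mult: "ev (p * q) = ev p \<otimes> ev q"
proof (induction p rule: poly_mapping_add_induct)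
  case (2 t c p)
  have "ev (Poly_Mapping.single t c * q) = ev (Poly_Mapping.single t c) \<otimes> ev q"
  proof (induction q rule: poly_mapping_add_induct)
    case (2 u d q)
    have "ev (Poly_Mapping.single t c * Poly_Mapping.single u d) =
        ev (Poly_Mapping.single t c) \<otimes> ev (Poly_Mapping.single u d)"
      by (simp add: mult_single ev_single hom mon_add R.m_ac)
    thus ?case using 2 by (simp add: distrib_left ev_add R.r_distr)
  qed simp
  thus ?case using 2 by (simp add: distrib_right ev_add R.l_distr)
qed simp

lemma ev_sum: "finite S \<Longrightarrow> ev (\<Sum>i\<in>S. f i) = (\<Oplus>i\<in>S. ev (f i))"
  by (induction S rule: finite_induct) (auto simp: ev_add)

section \<open>Coefficientwise evaluation of polynomials in x\<close>

definition Ev :: "'k mpoly poly \<Rightarrow> nat \<Rightarrow> 'r" where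
  "Ev p = (\<lambda>j. ev (poly.coeff p j))"

lemma Ev_closed [simp]: "Ev p \<in> carrier P"
  unfolding UP_carrier_iff
  by (auto simp: Ev_def Polynomial.coeff_eq_0 intro!: mem_upI exI[of _ "Polynomial.degree p"] bound.intro)

lemma Ev_add: "Ev (p + q) = Ev p \<oplus>\<^bsub>P\<^esub> Ev q"
  by (rule ext) (simp add: UP_apply, simp add: Ev_def ev_add)

lemma Ev_smult: "Ev (Polynomial.smult c p) = ev c \<odot>\<^bsub>P\<^esub> Ev p"
  by (rule ext) (simp add: UP_apply, simp add: Ev_def ev_mult)

lemma Ev_mult: "Ev (p * q) = Ev p \<otimes>\<^bsub>P\<^esub> Ev q"
  by (rule ext) (simp add: UP_apply, simp add: Ev_def Polynomial.coeff_mult ev_sum ev_mult)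

lemma Ev_1: "Ev 1 = \<one>\<^bsub>P\<^esub>"
  by (rule ext) (simp add: UP_apply Ev_def coeff_1)

lemma Ev_0: "Ev 0 = \<zero>\<^bsub>P\<^esub>"
  by (rule ext) (simp add: UP_apply Ev_def)

lemma Ev_lead:
  assumes "lead_at n p"
  shows "Ev p \<in> Fil n" "Ev p n = \<one>"
  using assms by (auto simp: Fil_def lead_at_def) (auto simp: Ev_def)

end

text \<open>The universal property of P(m, \<Gamma>): constants and variables determine a
  homomorphism. It later identifies evaluation at the residue classes of the variables with the
  residue map.\<close>

lemma (in mpoly_point) ev_unique:
  assumes \<chi>: "\<chi> \<in> ring_hom (PP m \<Gamma>) R"
    and const: "\<And>c. \<chi> (mconst c) = \<phi> c"
    and var: "\<And>\<nu> j. (\<nu>, j) \<in> Idx m \<Gamma> \<Longrightarrow> \<chi> (lam \<nu> j) = v (\<nu>, j)"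
    and p: "p \<in> carrier (PP m \<Gamma>)"
  shows "ev p = \<chi> p"
proof -
  interpret PP: cring "PP m \<Gamma>" by (rule PP_cring)
  have \<chi>0: "\<chi> 0 = \<zero>"
    using ring_hom_zero[OF \<chi> PP.ring_axioms R.ring_axioms] by (simp add: PP_simps)
  have \<chi>1: "\<chi> 1 = \<one>"
    using ring_hom_one[OF \<chi>] by (simp add: PP_simps)
  have \<chi>m: "\<chi> (p * q) = \<chi> p \<otimes> \<chi> q" if "p \<in> carrier (PP m \<Gamma>)" "q \<in> carrier (PP m \<Gamma>)" for p q
    using ring_hom_mult[OF \<chi> that] by (simp add: PP_simps)
  have \<chi>a: "\<chi> (p + q) = \<chi> p \<oplus> \<chi> q" if "p \<in> carrier (PP m \<Gamma>)" "q \<in> carrier (PP m \<Gamma>)" for p q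
    using ring_hom_add[OF \<chi> that] by (simp add: PP_simps)
  let ?X = "\<lambda>t. Poly_Mapping.single t 1 :: 'k mpoly"
  \<comment> \<open>The claim is built up from powers of one variable to monomials, then to
    polynomials, each time by multiplicativity or additivity of \<chi>.\<close>
  have pow: "mon (Poly_Mapping.single i n) = \<chi> (?X (Poly_Mapping.single i n))" if i: "i \<in> Idx m \<Gamma>" for i n
  proof (induction n)
    case (Suc n)
    obtain \<nu> j where ij: "i = (\<nu>, j)" by force
    have X: "?X (Poly_Mapping.single i k) \<in> carrier (PP m \<Gamma>)" for k
      using i by (intro PP_single) auto
    have "Poly_Mapping.single i (Suc n) = Poly_Mapping.single i 1 + Poly_Mapping.single i n"
      by (simp flip: single_add)
    moreover have "mon (Poly_Mapping.single i 1) = v i" by (simp add: mon_def)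
    moreover have "\<chi> (?X (Poly_Mapping.single i 1)) = v i" using var i by (simp add: ij lam_def)
    moreover have "?X (Poly_Mapping.single i 1 + Poly_Mapping.single i n) =
      ?X (Poly_Mapping.single i 1) * ?X (Poly_Mapping.single i n)" by (simp add: mult_single)
    ultimately show ?case using Suc X by (simp add: mon_add \<chi>m)
  qed (simp add: mon_0 \<chi>1)
  have mon: "mon t = \<chi> (?X t)" if "Poly_Mapping.keys t \<subseteq> Idx m \<Gamma>" for t
    using that
  proof (induction t rule: update_induct)
    case (update t i n)
    have t: "Poly_Mapping.update i n t = Poly_Mapping.single i n + t"
      using update by (intro update_eq_single_add)
    have k: "i \<in> Idx m \<Gamma>" "Poly_Mapping.keys t \<subseteq> Idx m \<Gamma>" using update by (auto simp: keys_update)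
    have "?X (Poly_Mapping.update i n t) = ?X (Poly_Mapping.single i n) * ?X t"
      by (simp add: mult_single t)
    moreover have "?X (Poly_Mapping.single i n) \<in> carrier (PP m \<Gamma>)" "?X t \<in> carrier (PP m \<Gamma>)"
      using k by (auto intro!: PP_single split: if_splits)
    ultimately show ?case using update k pow by (simp add: \<chi>m t mon_add)
  qed (simp add: mon_0 \<chi>1)
  show ?thesis
    using p
  proof (induction p rule: update_induct)
    case (update p t c)
    have t: "Poly_Mapping.update t c p = Poly_Mapping.single t c + p"
      using update by (intro update_eq_single_add)
    have k: "Poly_Mapping.keys t \<subseteq> Idx m \<Gamma>" "p \<in> carrier (PP m \<Gamma>)"
      using update by (auto simp: keys_update PP_simps(1))
    have "Poly_Mapping.single t c = mconst c * ?X t" by (simp add: mult_single mconst_def)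
    moreover have "mconst c \<in> carrier (PP m \<Gamma>)" "?X t \<in> carrier (PP m \<Gamma>)"
      unfolding mconst_def using k by (auto intro!: PP_single)
    ultimately have "\<chi> (Poly_Mapping.single t c) = \<phi> c \<otimes> \<chi> (?X t)"
      by (simp add: \<chi>m const)
    hence "ev (Poly_Mapping.single t c) = \<chi> (Poly_Mapping.single t c)"
      using k by (simp add: mon ev_single)
    thus ?case using update k by (simp add: t ev_add \<chi>a PP_single)
  qed (simp add: \<chi>0)
qed

text \<open>Setting the variables outside \<open>Idx m \<Gamma>\<close> to zero turns the partial evaluation on \<open>P(m, \<Gamma>)\<close>
  into a homomorphism on all polynomials.\<close>

lemma mpoly_eval_extend:
  fixes R :: "'r ring" and \<phi> :: "'k::field \<Rightarrow> 'r"
  assumes "cring R" "p \<in> carrier (PP m \<Gamma>)" "v \<in> Idx m \<Gamma> \<rightarrow> carrier R"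
    and "\<And>c. \<phi> c \<in> carrier R"
  shows "mpoly_eval R \<phi> v p = mpoly_eval R \<phi> (\<lambda>i. if i \<in> Idx m \<Gamma> then v i else \<zero>\<^bsub>R\<^esub>) p"
proof -
  interpret R: cring R by fact
  show ?thesis
    unfolding mpoly_eval_def
  proof (intro R.finsum_cong' arg_cong2[where f = "monoid.mult R"] R.finprod_cong' refl)
    fix t i assume "t \<in> Poly_Mapping.keys p" "i \<in> Poly_Mapping.keys t"
    hence "i \<in> Idx m \<Gamma>" using assms(2) by (auto simp: PP_simps(1))
    thus "v i [^]\<^bsub>R\<^esub> Poly_Mapping.lookup t i =
      (if i \<in> Idx m \<Gamma> then v i else \<zero>\<^bsub>R\<^esub>) [^]\<^bsub>R\<^esub> Poly_Mapping.lookup t i" by simp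
  qed (use assms in \<open>auto simp: Pi_def intro!: R.finprod_closed R.m_closed R.nat_pow_closed\<close>)
qed

lemma mpoly_eval_ring_hom:
  fixes R :: "'r ring" and \<phi> :: "'k::field \<Rightarrow> 'r"
  assumes "comm_algebra R \<phi>" "w \<in> Idx m \<Gamma> \<rightarrow> carrier R"
  shows "mpoly_eval R \<phi> w \<in> ring_hom (PP m \<Gamma>) R"
proof -
  interpret R: cring R using assms by (simp add: comm_algebra_def)
  interpret pt: mpoly_point R "UP R" \<phi> "\<lambda>i. if i \<in> Idx m \<Gamma> then w i else \<zero>\<^bsub>R\<^esub>"
    by unfold_locales (use assms in auto)
  note ext = mpoly_eval_extend[OF R.cring_axioms _ assms(2) comm_algebra_hom(1)[OF assms(1)]]
  show ?thesis
    by (rule ring_hom_memI)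
      (simp_all add: ext PP_simps(2-) PP_add PP_mult PP_1 pt.ev_add pt.ev_mult)
qed

section \<open>Points as zeros of the relations\<close>

locale gamma_setup =
  fixes m :: nat and \<Gamma> :: "nat set" and a :: "nat \<Rightarrow> nat \<Rightarrow> nat"
  assumes m: "m \<ge> 4" and \<Gamma>: "\<Gamma> \<in> SS m"
    and a_dec: "\<forall>\<gamma>\<in>dec \<Gamma>. a \<gamma> \<in> Rel \<Gamma> \<gamma>"
    and a_ind: "\<forall>\<nu>\<in>ind \<Gamma>. a \<nu> = unit_vec \<nu>"
begin

text \<open>The extra index 0 accounts for the basis element 1, which \<Gamma> does not
  record.\<close>

definition D :: "nat set" where
  "D = insert 0 \<Gamma>"

lemma \<Gamma>_bounds: "\<gamma> \<in> \<Gamma> \<Longrightarrow> 2 \<le> \<gamma> \<and> \<gamma> < m"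
  using \<Gamma> m by (force simp: SS_def)

lemma \<Gamma>_add: "\<alpha> \<in> \<Gamma> \<Longrightarrow> \<beta> \<in> \<Gamma> \<Longrightarrow> \<alpha> + \<beta> \<in> \<Gamma> \<or> m \<le> \<alpha> + \<beta>"
  using \<Gamma> by (auto simp: SS_def)

lemma finite_\<Gamma>: "finite \<Gamma>"
  by (rule finite_subset[of _ "{..<m}"]) (use \<Gamma>_bounds in auto)

lemma ind_\<Gamma>: "\<nu> \<in> ind \<Gamma> \<Longrightarrow> \<nu> \<in> \<Gamma>"
  by (simp add: ind_def)

lemma finite_ind: "finite (ind \<Gamma>)"
  using finite_\<Gamma> by (simp add: ind_def)

lemma D_bound: "D \<subseteq> {..<m}"
  using \<Gamma>_bounds m by (auto simp: D_def)

lemma D_minus: "n < m \<Longrightarrow> n \<notin> D \<longleftrightarrow> n \<in> {1..m - 1} - \<Gamma>"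
  by (auto simp: D_def)

lemma CC_iff: "j \<in> CC m \<Gamma> n \<longleftrightarrow> j \<notin> D \<and> n < j \<and> j < m"
  using m by (auto simp: CC_def D_def)

lemma a_Rel: "\<gamma> \<in> \<Gamma> \<Longrightarrow> a \<gamma> \<in> Rel \<Gamma> \<gamma>"
  using a_dec a_ind unit_vec_Rel[OF finite_ind] by (cases "\<gamma> \<in> dec \<Gamma>") (auto simp: ind_def)

lemma fpow_a_ind: "\<nu> \<in> ind \<Gamma> \<Longrightarrow> fpow m \<Gamma> (a \<nu>) = gen_f m \<Gamma> \<nu>"
  using a_ind finite_ind by (simp add: fpow_unit_vec)

lemma Idx_iff: "(\<nu>, j) \<in> Idx m \<Gamma> \<longleftrightarrow> \<nu> \<in> ind \<Gamma> \<and> j \<in> CC m \<Gamma> \<nu>"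
  by (simp add: Idx_def)

end

section \<open>Points as multiplicatively closed graded submodules\<close>

locale point_setup = UP_cring R P + gamma_setup m \<Gamma> a
  for R :: "'r ring" (structure) and P (structure) and m \<Gamma> a
begin

lemma uminus_smult: "h \<in> carrier P \<Longrightarrow> \<ominus>\<^bsub>P\<^esub> h = (\<ominus> \<one>) \<odot>\<^bsub>P\<^esub> h"
proof (rule P.minus_equality)
  assume h: "h \<in> carrier P"
  show "(\<ominus> \<one>) \<odot>\<^bsub>P\<^esub> h \<oplus>\<^bsub>P\<^esub> h = \<zero>\<^bsub>P\<^esub>"
    by (rule ext) (use h in \<open>simp add: UP_apply R.l_minus R.l_neg\<close>)
qed simp_all

text \<open>The definition of \<open>points\<close> constrains only indices from 1 on; index 0 of
  \<open>D\<close> is served by the constant 1. Additive inverses come from multiplication by the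
  scalar -1.\<close>

lemma points_iff: "A \<in> points R m \<Gamma> \<longleftrightarrow>
    graded_submodule D m A \<and> \<one>\<^bsub>P\<^esub> \<in> A \<and> (\<forall>p\<in>A. \<forall>q\<in>A. p \<otimes>\<^bsub>P\<^esub> q \<in> A)"
proof
  assume "A \<in> points R m \<Gamma>"
  hence sub: "subring A P" and sm: "\<forall>c\<in>carrier R. \<forall>f\<in>A. c \<odot>\<^bsub>P\<^esub> f \<in> A"
    and xm: "\<forall>g\<in>carrier P. up_ring.monom P \<one> m \<otimes>\<^bsub>P\<^esub> g \<in> A"
    and pos: "\<forall>\<gamma>\<in>\<Gamma>. \<exists>f\<in>A. f \<gamma> = \<one> \<and> (\<forall>j<\<gamma>. f j = \<zero>)"
    and neg: "\<forall>\<gamma>\<in>{1..m - 1} - \<Gamma>. \<forall>f\<in>A. (\<forall>j<\<gamma>. f j = \<zero>) \<longrightarrow> f \<gamma> = \<zero>"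
    by (auto simp: points_def P_def)
  note S = subringE[OF sub]
  have "Fil m \<subseteq> A" using xm by (auto simp: Fil_eq_monom_mult)
  moreover have "\<exists>f\<in>A. f \<in> Fil n \<and> f n = \<one>" if n: "n \<in> D" for n
  proof (cases "n = 0")
    case True
    thus ?thesis using S(3) by (intro bexI[of _ "\<one>\<^bsub>P\<^esub>"]) (auto simp: Fil_0 UP_apply)
  next
    case False
    then obtain f where "f \<in> A" "f n = \<one>" "\<forall>j<n. f j = \<zero>" using pos n by (auto simp: D_def)
    thus ?thesis using S(1) by (intro bexI[of _ f]) (auto simp: Fil_def)
  qed
  moreover have "f n = \<zero>" if "n < m" "n \<notin> D" "f \<in> A" "f \<in> Fil n" for n f
    using that neg D_minus[of n] by (simp add: Fil_def)
  ultimately have "graded_submodule D m A"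
    using S(1,7) sm unfolding graded_submodule_def by (intro conjI ballI allI impI) simp_all
  thus "graded_submodule D m A \<and> \<one>\<^bsub>P\<^esub> \<in> A \<and> (\<forall>p\<in>A. \<forall>q\<in>A. p \<otimes>\<^bsub>P\<^esub> q \<in> A)"
    using S(3,6) by blast
next
  assume A: "graded_submodule D m A \<and> \<one>\<^bsub>P\<^esub> \<in> A \<and> (\<forall>p\<in>A. \<forall>q\<in>A. p \<otimes>\<^bsub>P\<^esub> q \<in> A)"
  hence AP: "A \<subseteq> carrier P" and sm: "\<forall>c\<in>carrier R. \<forall>f\<in>A. c \<odot>\<^bsub>P\<^esub> f \<in> A"
    and F: "Fil m \<subseteq> A" and pos: "\<forall>n\<in>D. \<exists>f\<in>A. f \<in> Fil n \<and> f n = \<one>"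
    and neg: "\<forall>n<m. n \<notin> D \<longrightarrow> (\<forall>f\<in>A. f \<in> Fil n \<longrightarrow> f n = \<zero>)"
    and add: "\<forall>p\<in>A. \<forall>q\<in>A. p \<oplus>\<^bsub>P\<^esub> q \<in> A"
    unfolding graded_submodule_def by blast+
  have "subring A P"
  proof (rule P.subringI)
    fix h assume "h \<in> A"
    moreover from this have "h \<in> carrier P" using AP by blast
    ultimately show "\<ominus>\<^bsub>P\<^esub> h \<in> A" using sm by (simp add: uminus_smult)
  qed (use A AP add in auto)
  moreover have "\<exists>f\<in>A. f \<gamma> = \<one> \<and> (\<forall>j<\<gamma>. f j = \<zero>)" if "\<gamma> \<in> \<Gamma>" for \<gamma>
    using pos that by (force simp: D_def Fil_def)
  moreover have "f \<gamma> = \<zero>" if "\<gamma> \<in> {1..m - 1} - \<Gamma>" "f \<in> A" "\<forall>j<\<gamma>. f j = \<zero>" for f \<gamma>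
  proof -
    have "\<gamma> < m" using that m by auto
    moreover have "f \<in> Fil \<gamma>" using that AP by (auto simp: Fil_def)
    ultimately show ?thesis using neg that D_minus[of \<gamma>] by blast
  qed
  moreover have "up_ring.monom P \<one> m \<otimes>\<^bsub>P\<^esub> g \<in> A" if "g \<in> carrier P" for g
    using F that by (auto simp: Fil_eq_monom_mult)
  ultimately show "A \<in> points R m \<Gamma>"
    unfolding points_def P_def[symmetric] using sm by simp
qed

lemma canonical_over_ex1:
  assumes "A \<in> points R m \<Gamma>" "\<gamma> \<in> \<Gamma>"
  shows "\<exists>!f. f \<in> A \<and> f \<gamma> = \<one> \<and> (\<forall>j. j \<noteq> \<gamma> \<longrightarrow> j \<notin> CC m \<Gamma> \<gamma> \<longrightarrow> f j = \<zero>)"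
proof -
  have "\<gamma> \<in> D" using assms by (simp add: D_def)
  thus ?thesis
    using graded_submodule_canonical[of D m A \<gamma>] assms(1) D_bound by (simp add: CC_iff points_iff)
qed

lemma canonical_over_props:
  assumes "A \<in> points R m \<Gamma>" "\<gamma> \<in> \<Gamma>"
  shows "canonical_over R m \<Gamma> A \<gamma> \<in> A" "canonical_over R m \<Gamma> A \<gamma> \<gamma> = \<one>"
    "\<And>j. j \<noteq> \<gamma> \<Longrightarrow> j \<notin> CC m \<Gamma> \<gamma> \<Longrightarrow> canonical_over R m \<Gamma> A \<gamma> j = \<zero>"
  using theI'[OF canonical_over_ex1[OF assms]] unfolding canonical_over_def by blast+

lemma canonical_over_eqI:
  assumes "A \<in> points R m \<Gamma>" "\<gamma> \<in> \<Gamma>" "f \<in> A" "f \<gamma> = \<one>"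
    "\<And>j. j \<noteq> \<gamma> \<Longrightarrow> j \<notin> CC m \<Gamma> \<gamma> \<Longrightarrow> f j = \<zero>"
  shows "canonical_over R m \<Gamma> A \<gamma> = f"
  unfolding canonical_over_def
  by (rule the1_equality[OF canonical_over_ex1[OF assms(1,2)]]) (use assms in auto)

end

section \<open>The span attached to a choice of coordinates\<close>

locale rel_setup = point_setup R P m \<Gamma> a + mpoly_point R P \<phi> v
  for R :: "'r ring" (structure) and P (structure) and m \<Gamma> a and \<phi> :: "'k::field \<Rightarrow> 'r" and v
begin

definition F :: "nat \<Rightarrow> nat \<Rightarrow> 'r" where
  "F \<nu> = Ev (gen_f m \<Gamma> \<nu>)"

text \<open>Index 0 is treated separately because nothing is assumed about
  \<open>a 0\<close>.\<close>

definition B :: "nat \<Rightarrow> nat \<Rightarrow> 'r" where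
  "B \<gamma> = (if \<gamma> = 0 then \<one>\<^bsub>P\<^esub> else Ev (fpow m \<Gamma> (a \<gamma>)))"

definition V :: "(nat \<Rightarrow> 'r) set" where
  "V = {p. span_from B D m 0 p}"

definition relhold :: bool where
  "relhold \<longleftrightarrow> (\<forall>p\<in>relations m \<Gamma> a. ev p = \<zero>)"

lemma F_apply: "F \<nu> j = (if j = \<nu> then \<one> else if j \<in> CC m \<Gamma> \<nu> then v (\<nu>, j) else \<zero>)"
  by (simp add: F_def Ev_def coeff_gen_f ev_lam)

lemma F_Fil: "F \<nu> \<in> Fil \<nu>"
  unfolding F_def by (intro Ev_lead lead_at_gen_f)

lemma B_lead:
  assumes "n \<in> D"
  shows "B n \<in> Fil n" "B n n = \<one>"
proof -
  have "B n \<in> Fil n \<and> B n n = \<one>"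
  proof (cases "n = 0")
    case True
    thus ?thesis by (simp add: B_def Fil_0 UP_apply)
  next
    case False
    hence "lead_at n (fpow m \<Gamma> (a n) :: 'k mpoly poly)"
      using assms by (intro lead_at_fpow a_Rel) (simp add: D_def)
    thus ?thesis using Ev_lead False by (simp add: B_def)
  qed
  thus "B n \<in> Fil n" "B n n = \<one>" by auto
qed

lemma B_\<Gamma>: "\<gamma> \<in> \<Gamma> \<Longrightarrow> B \<gamma> = Ev (fpow m \<Gamma> (a \<gamma>))"
  using \<Gamma>_bounds[of \<gamma>] by (simp add: B_def)

lemma B_ind: "\<nu> \<in> ind \<Gamma> \<Longrightarrow> B \<nu> = F \<nu>"
  by (simp add: B_\<Gamma> ind_\<Gamma> fpow_a_ind F_def)

lemma V_graded: "graded_submodule D m V"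
  unfolding V_def using graded_submodule_span[OF D_bound B_lead] by simp

lemma V_closed:
  shows V_carrier: "p \<in> V \<Longrightarrow> p \<in> carrier P"
    and V_add: "p \<in> V \<Longrightarrow> q \<in> V \<Longrightarrow> p \<oplus>\<^bsub>P\<^esub> q \<in> V"
    and V_smult: "c \<in> carrier R \<Longrightarrow> p \<in> V \<Longrightarrow> c \<odot>\<^bsub>P\<^esub> p \<in> V"
    and Fil_V: "p \<in> Fil m \<Longrightarrow> p \<in> V"
  using V_graded by (auto simp: graded_submodule_def)

lemma B_V: "n \<in> D \<Longrightarrow> B n \<in> V"
  unfolding V_def mem_Collect_eq
  using D_bound by (intro span_from_le[OF D_bound B_lead _ g_span_from[OF D_bound B_lead]]) auto

lemma Ev_sum_V: "(\<And>i. i \<in> S \<Longrightarrow> Ev (f i) \<in> V) \<Longrightarrow> Ev (sum f S) \<in> V"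
  by (induction S rule: infinite_finite_induct) (auto simp: Ev_0 Ev_add V_add Fil_V zero_Fil)

text \<open>Multiplication by q is R-linear and maps \<open>Fil m\<close> into itself, so only the
  products with the \<open>B n\<close> have to be checked.\<close>

lemma V_mult_basis:
  assumes q: "q \<in> carrier P" and B: "\<And>n. n \<in> D \<Longrightarrow> B n \<otimes>\<^bsub>P\<^esub> q \<in> V" and p: "p \<in> V"
  shows "p \<otimes>\<^bsub>P\<^esub> q \<in> V"
proof -
  have "span_from B D m n p \<Longrightarrow> p \<otimes>\<^bsub>P\<^esub> q \<in> V" for n p
  proof (induction n p rule: span_from.induct)
    case (base p)
    thus ?case using Fil_mult[of p m q 0] q by (intro Fil_V) (simp add: Fil_0)
  next
    case (step n c p)
    have "p \<in> carrier P" "B n \<in> carrier P"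
      using span_from_carrier[OF D_bound B_lead step(4)] B_lead(1)[OF step(2)] Fil_carrier by auto
    hence "(c \<odot>\<^bsub>P\<^esub> B n \<oplus>\<^bsub>P\<^esub> p) \<otimes>\<^bsub>P\<^esub> q = c \<odot>\<^bsub>P\<^esub> (B n \<otimes>\<^bsub>P\<^esub> q) \<oplus>\<^bsub>P\<^esub> p \<otimes>\<^bsub>P\<^esub> q"
      using step q by (simp add: P.l_distr UP_smult_assoc2)
    thus ?case using step B by (simp add: V_add V_smult)
  qed
  thus ?thesis using p by (simp add: V_def)
qed

text \<open>Below m, the coefficients up to \<nu> + \<gamma> and those on \<Gamma> vanish
  identically; the remaining indices form \<open>CC m \<Gamma> (\<nu> + \<gamma>)\<close>, where the
  coefficients are relations.\<close>

lemma relpoly_Fil: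
  assumes relhold "\<nu> \<in> ind \<Gamma>" "\<gamma> \<in> \<Gamma>" "\<nu> + \<gamma> \<in> \<Gamma>" "(\<lambda>\<mu>. unit_vec \<nu> \<mu> + a \<gamma> \<mu>) \<noteq> a (\<nu> + \<gamma>)"
  shows "Ev (relpoly m \<Gamma> a \<nu> \<gamma>) \<in> Fil m"
proof -
  have "ev (poly.coeff (relpoly m \<Gamma> a \<nu> \<gamma>) j) = \<zero>" if "j < m" for j
  proof (cases "j \<le> \<nu> + \<gamma> \<or> j \<in> \<Gamma>")
    case True
    hence "poly.coeff (relpoly m \<Gamma> a \<nu> \<gamma>) j = (0 :: 'k mpoly)"
      by (intro coeff_relpoly_0 finite_\<Gamma> a_Rel assms)
    thus ?thesis by simp
  next
    case False
    hence "(\<nu>, \<gamma>, j) \<in> rel_index m \<Gamma> a"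
      using assms that by (auto simp: rel_index_def CC_def)
    hence "(poly.coeff (relpoly m \<Gamma> a \<nu> \<gamma>) j :: 'k mpoly) \<in> relations m \<Gamma> a"
      by (force simp: relations_def)
    thus ?thesis using assms(1) by (simp add: relhold_def)
  qed
  thus ?thesis unfolding Fil_def by (simp, simp add: Ev_def)
qed

lemma gen_f_mult_fpow:
  "(gen_f m \<Gamma> \<nu> * fpow m \<Gamma> (a \<gamma>) :: 'k mpoly poly) =
    relpoly m \<Gamma> a \<nu> \<gamma> + fpow m \<Gamma> (a (\<nu> + \<gamma>)) +
    (\<Sum>\<delta>\<in>above \<Gamma> (\<nu> + \<gamma>). Polynomial.smult (eta m \<Gamma> a \<nu> \<gamma> \<delta>) (fpow m \<Gamma> (a \<delta>)))"
  by (simp add: relpoly_def)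

text \<open>On the basis: n = 0 gives \<open>F \<nu>\<close> itself; if \<nu> + n is not in
  \<Gamma>, it is at least m and the product lies in \<open>Fil m\<close>; otherwise the relation
  for (\<nu>, n) rewrites the product inside \<open>V\<close>.\<close>

lemma V_mult_F:
  assumes relhold "\<nu> \<in> ind \<Gamma>" "p \<in> V"
  shows "p \<otimes>\<^bsub>P\<^esub> F \<nu> \<in> V"
proof (rule V_mult_basis)
  show F: "F \<nu> \<in> carrier P" by (simp add: F_def)
  have \<nu>: "\<nu> \<in> \<Gamma>" "\<nu> \<in> D" using ind_\<Gamma> assms by (auto simp: D_def)
  fix n assume n: "n \<in> D"
  show "B n \<otimes>\<^bsub>P\<^esub> F \<nu> \<in> V"
  proof (cases "n = 0")
    case True
    thus ?thesis using F B_V[OF \<nu>(2)] B_ind[OF assms(2)] by (simp add: B_def)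
  next
    case False
    hence n\<Gamma>: "n \<in> \<Gamma>" using n by (simp add: D_def)
    show ?thesis
    proof (cases "\<nu> + n \<in> \<Gamma>")
      case False
      hence "m \<le> n + \<nu>" using \<Gamma>_add[OF \<nu>(1) n\<Gamma>] by simp
      thus ?thesis using Fil_mult[OF B_lead(1)[OF n] F_Fil] Fil_mono by (blast intro: Fil_V)
    next
      case True
      have eq: "B n \<otimes>\<^bsub>P\<^esub> F \<nu> = Ev (gen_f m \<Gamma> \<nu> * fpow m \<Gamma> (a n))"
        by (simp add: B_\<Gamma>[OF n\<Gamma>] F_def Ev_mult P.m_comm)
      have BV: "Ev (fpow m \<Gamma> (a \<delta>)) \<in> V" if "\<delta> \<in> \<Gamma>" for \<delta>
        using B_V[of \<delta>] that by (simp add: B_\<Gamma> D_def)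
      show ?thesis
      \<comment> \<open>Pairs with equal exponent vectors carry no relation: there the product is
        already the basis element of index \<nu> + n.\<close>
      proof (cases "(\<lambda>\<mu>. unit_vec \<nu> \<mu> + a n \<mu>) = a (\<nu> + n)")
        case eq': True
        have "gen_f m \<Gamma> \<nu> * fpow m \<Gamma> (a n) = (fpow m \<Gamma> (a (\<nu> + n)) :: 'k mpoly poly)"
          by (simp add: fpow_add fpow_unit_vec[OF finite_ind assms(2)] flip: eq')
        thus ?thesis using eq BV[OF True] by simp
      next
        case False
        have "Ev (relpoly m \<Gamma> a \<nu> n) \<in> V"
          using relpoly_Fil[OF assms(1,2) n\<Gamma> True False] by (rule Fil_V)
        moreover have "Ev (\<Sum>\<delta>\<in>above \<Gamma> (\<nu> + n). Polynomial.smult (eta m \<Gamma> a \<nu> n \<delta>) (fpow m \<Gamma> (a \<delta>))) \<in> V"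
          using BV by (intro Ev_sum_V) (auto simp: Ev_smult above_def intro!: V_smult)
        ultimately show ?thesis
          unfolding eq gen_f_mult_fpow using BV[OF True] by (simp add: Ev_add V_add)
      qed
    qed
  qed
qed (fact assms)

text \<open>The polynomials whose evaluation multiplies \<open>V\<close> into itself contain the
  generators and are closed under products, hence contain every f^b. This gives the products with
  the basis, and linearity the rest.\<close>

lemma V_mult:
  assumes relhold "p \<in> V" "q \<in> V"
  shows "p \<otimes>\<^bsub>P\<^esub> q \<in> V"
proof -
  define M where "M = {Q :: 'k mpoly poly. \<forall>p\<in>V. p \<otimes>\<^bsub>P\<^esub> Ev Q \<in> V}"
  have M1: "1 \<in> M" by (auto simp: M_def Ev_1 V_carrier)
  have Mm: "Q * Q' \<in> M" if "Q \<in> M" "Q' \<in> M" for Q Q'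
  proof -
    have "p \<otimes>\<^bsub>P\<^esub> Ev (Q * Q') = (p \<otimes>\<^bsub>P\<^esub> Ev Q) \<otimes>\<^bsub>P\<^esub> Ev Q'" if "p \<in> V" for p
      using that by (simp add: Ev_mult P.m_assoc V_carrier)
    thus ?thesis using that by (simp add: M_def)
  qed
  have "gen_f m \<Gamma> \<nu> \<in> M" if "\<nu> \<in> ind \<Gamma>" for \<nu>
    using V_mult_F[OF assms(1) that] by (simp add: M_def F_def)
  hence fpow: "fpow m \<Gamma> b \<in> M" for b
    using M1 Mm by (intro fpow_mem)
  \<comment> \<open>The factors are swapped so that p acts as the fixed multiplier while q is
    expanded in the basis.\<close>
  have "q \<otimes>\<^bsub>P\<^esub> p \<in> V"
  proof (rule V_mult_basis[OF V_carrier[OF assms(2)] _ assms(3)])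
    fix n assume "n \<in> D"
    hence "p \<otimes>\<^bsub>P\<^esub> B n \<in> V" using fpow assms(2) by (simp add: B_def M_def V_carrier)
    moreover have "B n \<in> carrier P" using B_V[OF \<open>n \<in> D\<close>] by (rule V_carrier)
    ultimately show "B n \<otimes>\<^bsub>P\<^esub> p \<in> V" using V_carrier[OF assms(2)] by (simp add: P.m_comm)
  qed
  thus ?thesis using assms V_carrier by (simp add: P.m_comm)
qed

lemma V_points:
  assumes relhold
  shows "V \<in> points R m \<Gamma>"
  unfolding points_iff using V_graded V_mult[OF assms] B_V[of 0] by (simp add: B_def D_def)

text \<open>\<open>F \<nu>\<close> lies in \<open>V\<close> and has the canonical shape, so
  uniqueness identifies it. Hence the coordinates of \<open>V\<close> are the given values v, which
  yields surjectivity of the coordinate map.\<close>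

lemma canonical_over_V:
  assumes relhold "\<nu> \<in> ind \<Gamma>"
  shows "canonical_over R m \<Gamma> V \<nu> = F \<nu>"
proof (rule canonical_over_eqI[OF V_points[OF assms(1)]])
  show "\<nu> \<in> \<Gamma>" using assms ind_\<Gamma> by simp
  thus "F \<nu> \<in> V" using B_V[of \<nu>] B_ind[OF assms(2)] by (simp add: D_def)
qed (auto simp: F_apply)

text \<open>A contains all \<open>B n\<close>, and a graded submodule is determined by such a
  family, so A is \<open>V\<close>. Each relation polynomial then evaluates into \<open>V\<close>
  with zero coefficients on \<open>D\<close>, so all its coefficients below m vanish.\<close>

lemma point_eq_V:
  assumes A: "A \<in> points R m \<Gamma>" and F: "\<And>\<nu>. \<nu> \<in> ind \<Gamma> \<Longrightarrow> F \<nu> \<in> A"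
  shows "A = V" and relhold
proof -
  have gr: "graded_submodule D m A" and A1: "\<one>\<^bsub>P\<^esub> \<in> A" and Am: "\<And>p q. p \<in> A \<Longrightarrow> q \<in> A \<Longrightarrow> p \<otimes>\<^bsub>P\<^esub> q \<in> A"
    using A by (auto simp: points_iff)
  define M where "M = {Q :: 'k mpoly poly. Ev Q \<in> A}"
  have M1: "1 \<in> M" and Mm: "Q \<in> M \<Longrightarrow> Q' \<in> M \<Longrightarrow> Q * Q' \<in> M" for Q Q'
    using A1 Am by (auto simp: M_def Ev_1 Ev_mult)
  have gen: "gen_f m \<Gamma> \<nu> \<in> M" if "\<nu> \<in> ind \<Gamma>" for \<nu>
    using F[OF that] by (simp add: M_def F_def)
  hence fpow: "fpow m \<Gamma> b \<in> M" for b
    using M1 Mm by (intro fpow_mem)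
  have BA: "B n \<in> A" if "n \<in> D" for n
    using fpow A1 by (simp add: B_def M_def)
  show AV: "A = V"
    unfolding V_def by (rule graded_submodule_eq_span[OF D_bound B_lead gr BA])
  show relhold
    unfolding relhold_def
  proof
    fix p :: "'k mpoly" assume "p \<in> relations m \<Gamma> a"
    then obtain \<nu> \<gamma> j where *: "\<nu> \<in> ind \<Gamma>" "\<gamma> \<in> \<Gamma>" "\<nu> + \<gamma> \<in> \<Gamma>" "j \<in> CC m \<Gamma> (\<nu> + \<gamma>)"
      and p: "p = poly.coeff (relpoly m \<Gamma> a \<nu> \<gamma>) j"
      by (auto simp: relations_def rel_index_def)
    let ?r = "relpoly m \<Gamma> a \<nu> \<gamma> :: 'k mpoly poly"
    let ?s = "fpow m \<Gamma> (a (\<nu> + \<gamma>)) + (\<Sum>\<delta>\<in>above \<Gamma> (\<nu> + \<gamma>). Polynomial.smult (eta m \<Gamma> a \<nu> \<gamma> \<delta>) (fpow m \<Gamma> (a \<delta>)))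
      :: 'k mpoly poly"
    have "Ev ?s \<in> V"
      using fpow unfolding Ev_add M_def AV
      by (intro V_add Ev_sum_V) (auto simp: Ev_smult intro!: V_smult)
    hence "Ev (Polynomial.smult (- 1) ?s) \<in> V"
      unfolding Ev_smult by (intro V_smult) auto
    moreover have "Ev (gen_f m \<Gamma> \<nu> * fpow m \<Gamma> (a \<gamma>)) \<in> V"
      using Mm[OF gen[OF *(1)] fpow] by (simp add: M_def AV)
    moreover have "?r = gen_f m \<Gamma> \<nu> * fpow m \<Gamma> (a \<gamma>) + Polynomial.smult (- 1) ?s"
      by (simp add: relpoly_def)
    ultimately have r: "Ev ?r \<in> V" by (simp only: Ev_add V_add)
    have "Ev ?r n = \<zero>" if "n \<in> D" for n
    proof -
      \<comment> \<open>Index 0 of \<open>D\<close> falls under the alternative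
        \<open>j \<le> \<nu> + \<gamma>\<close> of \<open>coeff_relpoly_0\<close>.\<close>
      have "poly.coeff ?r n = (0 :: 'k mpoly)"
        using that by (intro coeff_relpoly_0 finite_\<Gamma> a_Rel *) (auto simp: D_def)
      thus ?thesis by (simp add: Ev_def)
    qed
    hence "Ev ?r \<in> Fil m" by (rule graded_submodule_vanish[OF V_graded r])
    thus "ev p = \<zero>" using *(4) by (simp add: Fil_def CC_iff p) (simp add: Ev_def)
  qed
qed

end

section \<open>The coordinate bijection between points and zeros of the relations\<close>

context gamma_setup
begin

text \<open>A point is recovered as the span \<open>V\<close> of its own coordinates, which gives
  injectivity and the relations. Conversely, at a zero of the relations \<open>V\<close> is a point
  with the given coordinates.\<close>

lemma coords_over_bij:
  fixes R :: "'r ring" and \<phi> :: "'k::field \<Rightarrow> 'r"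
  assumes alg: "comm_algebra R \<phi>"
  shows "bij_betw (coords_over R m \<Gamma>) (points R m \<Gamma>) (zero_set R \<phi> m \<Gamma> (relations m \<Gamma> a))"
proof -
  interpret R: cring R using alg by (simp add: comm_algebra_def)
  interpret pt: point_setup R "UP R" m \<Gamma> a
    by unfold_locales simp
  \<comment> \<open>Coordinate vectors are \<open>undefined\<close> outside
    \<open>Idx m \<Gamma>\<close>; the value 0 there meets the totality demanded of v.\<close>
  define ext where "ext w = (\<lambda>i. if i \<in> Idx m \<Gamma> then w i else \<zero>\<^bsub>R\<^esub>)" for w :: "nat \<times> nat \<Rightarrow> 'r"
  let ?c = "coords_over R m \<Gamma>"
  have rs: "rel_setup R m \<Gamma> a \<phi> (ext w)" if "w \<in> Idx m \<Gamma> \<rightarrow>\<^sub>E carrier R" for w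
    by unfold_locales (use alg that in \<open>auto simp: ext_def\<close>)
  have zs: "w \<in> zero_set R \<phi> m \<Gamma> (relations m \<Gamma> a) \<longleftrightarrow>
      rel_setup.relhold R m \<Gamma> a \<phi> (ext w)" if w: "w \<in> Idx m \<Gamma> \<rightarrow>\<^sub>E carrier R" for w
  proof -
    interpret rel_setup R "UP R" m \<Gamma> a \<phi> "ext w" by (rule rs[OF w])
    have "mpoly_eval R \<phi> w p = mpoly_eval R \<phi> (ext w) p" if "p \<in> relations m \<Gamma> a" for p
      unfolding ext_def
      by (rule mpoly_eval_extend[OF R.cring_axioms subsetD[OF relations_subset that]]) (use w hom in auto)
    thus ?thesis using w by (auto simp: zero_set_def relhold_def)
  qed
  have cw: "?c A \<in> Idx m \<Gamma> \<rightarrow>\<^sub>E carrier R" if A: "A \<in> points R m \<Gamma>" for A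
  proof -
    have "canonical_over R m \<Gamma> A \<nu> j \<in> carrier R" if "\<nu> \<in> ind \<Gamma>" for \<nu> j
    proof -
      have "canonical_over R m \<Gamma> A \<nu> \<in> A" using pt.canonical_over_props(1)[OF A ind_\<Gamma>[OF that]] .
      hence "canonical_over R m \<Gamma> A \<nu> \<in> carrier (UP R)"
        using A by (auto simp: pt.points_iff pt.graded_submodule_def)
      thus ?thesis by (rule pt.UP_apply(1))
    qed
    thus ?thesis by (auto simp: coords_over_def Idx_def)
  qed
  have key: "A = rel_setup.V R m \<Gamma> a \<phi> (ext (?c A)) \<and> rel_setup.relhold R m \<Gamma> a \<phi> (ext (?c A))"
    if A: "A \<in> points R m \<Gamma>" for A
  proof -
    interpret rel_setup R "UP R" m \<Gamma> a \<phi> "ext (?c A)" by (rule rs[OF cw[OF A]])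
    \<comment> \<open>Built from the coordinates of A, the generators \<open>F \<nu>\<close> are the
      canonical elements of A, so \<open>point_eq_V\<close> applies.\<close>
    have "F \<nu> = canonical_over R m \<Gamma> A \<nu>" if "\<nu> \<in> ind \<Gamma>" for \<nu>
      using pt.canonical_over_props[OF A ind_\<Gamma>[OF that]] that
      unfolding fun_eq_iff F_apply by (auto simp: ext_def coords_over_def Idx_def)
    hence "F \<nu> \<in> A" if "\<nu> \<in> ind \<Gamma>" for \<nu>
      using pt.canonical_over_props(1)[OF A ind_\<Gamma>[OF that]] that by simp
    thus ?thesis using point_eq_V[OF A] by blast
  qed
  show ?thesis
  proof (rule bij_betw_imageI)
    show "inj_on ?c (points R m \<Gamma>)"
    proof (rule inj_onI)
      fix A A' assume "A \<in> points R m \<Gamma>" "A' \<in> points R m \<Gamma>" "?c A = ?c A'"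
      thus "A = A'" using key[of A] key[of A'] by argo
    qed
    show "?c ` points R m \<Gamma> = zero_set R \<phi> m \<Gamma> (relations m \<Gamma> a)"
    proof
      show "?c ` points R m \<Gamma> \<subseteq> zero_set R \<phi> m \<Gamma> (relations m \<Gamma> a)"
        using key zs[OF cw] by auto
      show "zero_set R \<phi> m \<Gamma> (relations m \<Gamma> a) \<subseteq> ?c ` points R m \<Gamma>"
      proof
        fix w assume w: "w \<in> zero_set R \<phi> m \<Gamma> (relations m \<Gamma> a)"
        hence wE: "w \<in> Idx m \<Gamma> \<rightarrow>\<^sub>E carrier R" by (simp add: zero_set_def)
        interpret rel_setup R "UP R" m \<Gamma> a \<phi> "ext w" by (rule rs[OF wE])
        have rel: relhold using zs[OF wE] w by simp
        have "?c V i = w i" for i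
        proof (cases "i \<in> Idx m \<Gamma>")
          case True
          then obtain \<nu> j where i: "i = (\<nu>, j)" "\<nu> \<in> ind \<Gamma>" "j \<in> CC m \<Gamma> \<nu>" by (auto simp: Idx_def)
          have "?c V i = F \<nu> j"
            using canonical_over_V[OF rel i(2)] True i(1) by (simp add: coords_over_def)
          also have "\<dots> = ext w i" unfolding F_apply using i by (simp add: CC_iff)
          finally show ?thesis using True by (simp add: ext_def)
        next
          \<comment> \<open>Outside \<open>Idx m \<Gamma>\<close> both functions are
            \<open>undefined\<close>, on one side by \<open>restrict\<close>, on the other by
            extensionality of w.\<close>
          case False
          thus ?thesis using wE by (simp add: coords_over_def PiE_arb[OF wE])
        qed
        thus "w \<in> ?c ` points R m \<Gamma>" using V_points[OF rel] by (intro image_eqI[of _ _ V]) auto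
      qed
    qed
  qed
qed

lemma coords_over_closed:
  fixes R :: "'r ring" and \<phi> :: "'k::field \<Rightarrow> 'r"
  assumes "comm_algebra R \<phi>" "A \<in> points R m \<Gamma>"
  shows "coords_over R m \<Gamma> A \<in> zero_set R \<phi> m \<Gamma> (relations m \<Gamma> a)"
    and "coords_over R m \<Gamma> A \<in> Idx m \<Gamma> \<rightarrow> carrier R"
  using bij_betwE[OF coords_over_bij[OF assms(1)]] assms(2) by (auto simp: zero_set_def)

end

section \<open>Regular functions\<close>

context gamma_setup
begin

text \<open>The case R = K with the identity as structure map, transported along the injective
  passage from polynomials to coefficient functions.\<close>

lemma coords_bij:
  "bij_betw (coords m \<Gamma>) (algebras_of_type m \<Gamma> :: 'k::field poly set set)
    (zero_set ring_of_type_algebra (\<lambda>c. c) m \<Gamma> (relations m \<Gamma> a :: 'k mpoly set))"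
proof -
  let ?K = "ring_of_type_algebra :: 'k ring"
  let ?im = "(`) poly.coeff :: 'k poly set \<Rightarrow> (nat \<Rightarrow> 'k) set"
  have K: "cring ?K" by (rule cring_from_type_algebra)
  interpret K: cring ?K by (rule K)
  interpret pt: point_setup ?K "UP ?K" m \<Gamma> a by unfold_locales simp
  have pts: "points ?K m \<Gamma> = ?im ` algebras_of_type m \<Gamma>" by (rule points_field[OF m \<Gamma>])
  have alg: "comm_algebra ?K (\<lambda>c. c)"
    using K by (auto simp: comm_algebra_def ring_hom_def)
  have "bij_betw ?im (algebras_of_type m \<Gamma>) (points ?K m \<Gamma>)"
    unfolding pts by (intro bij_betw_imageI) (auto intro!: inj_onI simp: inj_image_eq_iff inj_def poly.coeff_inject)
  from bij_betw_trans[OF this coords_over_bij[OF alg]]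
  have "bij_betw (coords_over ?K m \<Gamma> \<circ> ?im) (algebras_of_type m \<Gamma>)
    (zero_set ?K (\<lambda>c. c) m \<Gamma> (relations m \<Gamma> a))" .
  moreover have "(coords_over ?K m \<Gamma> \<circ> ?im) A = coords m \<Gamma> A" if A: "A \<in> algebras_of_type m \<Gamma>" for A
  proof -
    have A': "?im A \<in> points ?K m \<Gamma>" using A pts by blast
    \<comment> \<open>The two definite descriptions select the same element, one as a polynomial and
      one as a coefficient function.\<close>
    have "canonical_over ?K m \<Gamma> (?im A) \<nu> = poly.coeff (canonical m \<Gamma> A \<nu>)" if "\<nu> \<in> ind \<Gamma>" for \<nu>
    proof -
      let ?Q = "\<lambda>f. f \<in> A \<and> poly.coeff f \<nu> = 1 \<and> (\<forall>j. j \<noteq> \<nu> \<longrightarrow> j \<notin> CC m \<Gamma> \<nu> \<longrightarrow> poly.coeff f j = 0)"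
      note \<nu> = ind_\<Gamma>[OF that]
      note c = pt.canonical_over_props[OF A' \<nu>, unfolded K_simps]
      obtain f where f: "f \<in> A" "canonical_over ?K m \<Gamma> (?im A) \<nu> = poly.coeff f"
        using c(1) by auto
      have "?Q f" using f c by simp
      moreover have "g = f" if "?Q g" for g
      proof -
        have "canonical_over ?K m \<Gamma> (?im A) \<nu> = poly.coeff g"
          by (rule pt.canonical_over_eqI[OF A' \<nu>]) (use that in \<open>auto simp: K_simps\<close>)
        thus ?thesis using f by (simp add: poly.coeff_inject)
      qed
      ultimately have "canonical m \<Gamma> A \<nu> = f" unfolding canonical_def by (rule the_equality)
      thus ?thesis using f by simp
    qed
    thus ?thesis by (auto simp: coords_over_def coords_def Idx_def fun_eq_iff restrict_def)
  qed
  ultimately show ?thesis using bij_betw_cong by blast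
qed

section \<open>The homomorphism from P(m, \<Gamma>) to the regular functions and its kernel\<close>

lemma all_pointsD:
  assumes "(R, \<phi>, A) \<in> all_points m \<Gamma>"
  shows "comm_algebra R \<phi>" "A \<in> points R m \<Gamma>"
  using assms by (auto simp: all_points_def)

lemma reg_fun_hom: "reg_fun m \<Gamma> \<in> ring_hom (PP m \<Gamma> :: 'k::field mpoly ring) (reg_ring m \<Gamma>)"
proof -
  have hom: "mpoly_eval R \<phi> (coords_over R m \<Gamma> A) \<in> ring_hom (PP m \<Gamma>) R"
    if "(R, \<phi>, A) \<in> all_points m \<Gamma>"
    for R \<phi> and A :: "(nat \<Rightarrow> 'k mpoly set) set"
    using mpoly_eval_ring_hom coords_over_closed(2) all_pointsD[OF that] by blast
  show ?thesis
  proof (rule ring_hom_memI)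
    fix p q :: "'k mpoly" assume pq: "p \<in> carrier (PP m \<Gamma>)" "q \<in> carrier (PP m \<Gamma>)"
    show "reg_fun m \<Gamma> p \<in> carrier (reg_ring m \<Gamma>)" using pq by (simp add: reg_ring_def)
    show "reg_fun m \<Gamma> (p \<otimes>\<^bsub>PP m \<Gamma>\<^esub> q) = reg_fun m \<Gamma> p \<otimes>\<^bsub>reg_ring m \<Gamma>\<^esub> reg_fun m \<Gamma> q"
      using ring_hom_mult[OF hom pq] by (auto simp: reg_ring_def reg_fun_def restrict_def fun_eq_iff)
    show "reg_fun m \<Gamma> (p \<oplus>\<^bsub>PP m \<Gamma>\<^esub> q) = reg_fun m \<Gamma> p \<oplus>\<^bsub>reg_ring m \<Gamma>\<^esub> reg_fun m \<Gamma> q"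
      using ring_hom_add[OF hom pq] by (auto simp: reg_ring_def reg_fun_def restrict_def fun_eq_iff)
  next
    show "reg_fun m \<Gamma> \<one>\<^bsub>PP m \<Gamma> :: 'k mpoly ring\<^esub> = \<one>\<^bsub>reg_ring m \<Gamma>\<^esub>"
      using ring_hom_one[OF hom] by (auto simp: reg_ring_def reg_fun_def intro!: restrict_ext)
  qed
qed

lemma reg_fun_zero: "reg_fun m \<Gamma> 0 = (\<zero>\<^bsub>reg_ring m \<Gamma>\<^esub> :: 'k::field point \<Rightarrow> 'k mpoly set)"
  by (auto simp: reg_fun_def reg_ring_def restrict_def fun_eq_iff mpoly_eval_def all_points_def
      comm_algebra_def cring_def ring_def abelian_group_def abelian_monoid.finsum_empty)

text \<open>The ring axioms for the regular functions are inherited from P(m, \<Gamma>), because the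
  carrier is the image of a homomorphism. The image ring takes the image of 0 as its zero, which
  \<open>reg_fun_zero\<close> matches with the zero function.\<close>

lemma reg_fun_ring_hom_ring:
  "ring_hom_ring (PP m \<Gamma> :: 'k::field mpoly ring) (reg_ring m \<Gamma>) (reg_fun m \<Gamma>)"
proof (rule ring_hom_ringI2)
  interpret PP: cring "PP m \<Gamma> :: 'k mpoly ring" by (rule PP_cring)
  show "ring (PP m \<Gamma> :: 'k mpoly ring)" by (rule PP.ring_axioms)
  have "ring (reg_ring m \<Gamma> \<lparr>carrier := reg_fun m \<Gamma> ` carrier (PP m \<Gamma> :: 'k mpoly ring), zero := reg_fun m \<Gamma> \<zero>\<^bsub>PP m \<Gamma>\<^esub>\<rparr>)"
    by (rule PP.ring_hom_imp_img_ring[OF reg_fun_hom])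
  moreover have "reg_ring m \<Gamma> \<lparr>carrier := reg_fun m \<Gamma> ` carrier (PP m \<Gamma> :: 'k mpoly ring), zero := reg_fun m \<Gamma> \<zero>\<^bsub>PP m \<Gamma>\<^esub>\<rparr>
    = reg_ring m \<Gamma>"
    unfolding PP_simps reg_fun_zero by (simp add: reg_ring_def)
  ultimately show "ring (reg_ring m \<Gamma> :: ('k point \<Rightarrow> 'k mpoly set) ring)" by simp
qed (rule reg_fun_hom)

text \<open>The coordinates of the universal point are the residue classes of the variables in
  \<open>P(m, \<Gamma>) / I\<close>, so that evaluating a polynomial there gives its own residue class.\<close>

lemma reg_fun_eq_zero_imp:
  defines "I \<equiv> Idl\<^bsub>PP m \<Gamma>\<^esub> (relations m \<Gamma> a :: 'k::field mpoly set)"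
  assumes p: "p \<in> carrier (PP m \<Gamma>)" and 0: "reg_fun m \<Gamma> p = \<zero>\<^bsub>reg_ring m \<Gamma>\<^esub>"
  shows "p \<in> I"
proof -
  let ?PP = "PP m \<Gamma> :: 'k mpoly ring"
  interpret PP: cring ?PP by (rule PP_cring)
  interpret I: ideal I ?PP unfolding I_def by (rule PP.genideal_ideal[OF relations_subset])
  \<comment> \<open>Elements of the quotient are cosets, hence of type \<open>'k mpoly set\<close>,
    so \<open>Q\<close> is among the algebras over which \<open>all_points\<close> ranges.\<close>
  define Q where "Q = ?PP Quot I"
  define \<chi> where "\<chi> = (+>\<^bsub>?PP\<^esub>) I"
  define \<phi> where "\<phi> c = \<chi> (mconst c)" for c
  define w where "w = restrict (\<lambda>(\<nu>, j). \<chi> (lam \<nu> j)) (Idx m \<Gamma>)"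
  interpret Q: cring Q unfolding Q_def by (rule I.quotient_is_cring[OF PP.cring_axioms])
  have \<chi>: "\<chi> \<in> ring_hom ?PP Q" unfolding \<chi>_def Q_def by (rule I.rcos_ring_hom)
  have mc: "mconst c \<in> carrier ?PP" for c
    unfolding mconst_def by (rule PP_single) simp
  have alg: "comm_algebra Q \<phi>"
    unfolding comm_algebra_def
  proof (intro conjI Q.cring_axioms ring_hom_memI)
    fix x y :: 'k
    show "\<phi> x \<in> carrier Q" unfolding \<phi>_def by (rule ring_hom_closed[OF \<chi> mc])
    have "mconst (x * y) = mconst x * mconst y" "mconst (x + y) = mconst x + mconst y"
      by (simp_all add: mconst_def mult_single single_add)
    thus "\<phi> (x \<otimes>\<^bsub>ring_of_type_algebra\<^esub> y) = \<phi> x \<otimes>\<^bsub>Q\<^esub> \<phi> y"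
      "\<phi> (x \<oplus>\<^bsub>ring_of_type_algebra\<^esub> y) = \<phi> x \<oplus>\<^bsub>Q\<^esub> \<phi> y"
      using ring_hom_mult[OF \<chi> mc mc] ring_hom_add[OF \<chi> mc mc]
      by (simp_all add: \<phi>_def K_simps PP_simps)
    have "mconst 1 = (1 :: 'k mpoly)" by (simp add: mconst_def)
    thus "\<phi> \<one>\<^bsub>ring_of_type_algebra\<^esub> = \<one>\<^bsub>Q\<^esub>"
      using ring_hom_one[OF \<chi>] by (simp add: \<phi>_def K_simps PP_simps)
  qed
  have w: "w \<in> Idx m \<Gamma> \<rightarrow>\<^sub>E carrier Q"
    using ring_hom_closed[OF \<chi> lam_PP] by (auto simp: w_def Idx_iff)
  have eval: "mpoly_eval Q \<phi> w p = \<chi> p" if "p \<in> carrier ?PP" for p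
  proof -
    interpret pt: mpoly_point Q "UP Q" \<phi> "\<lambda>i. if i \<in> Idx m \<Gamma> then w i else \<zero>\<^bsub>Q\<^esub>"
      by unfold_locales (use alg w in auto)
    have "mpoly_eval Q \<phi> w p = pt.ev p"
      by (rule mpoly_eval_extend[OF Q.cring_axioms that]) (use w pt.hom in auto)
    also have "\<dots> = \<chi> p"
      by (rule pt.ev_unique[OF \<chi> _ _ that]) (auto simp: \<phi>_def w_def)
    finally show ?thesis .
  qed
  have zero: "\<zero>\<^bsub>Q\<^esub> = I" by (simp add: Q_def FactRing_def)
  have "w \<in> zero_set Q \<phi> m \<Gamma> (relations m \<Gamma> a)"
  proof -
    have "mpoly_eval Q \<phi> w r = \<zero>\<^bsub>Q\<^esub>" if "r \<in> relations m \<Gamma> a" for r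
    proof -
      have "r \<in> I" using PP.genideal_self[OF relations_subset] that unfolding I_def by blast
      moreover have "r \<in> carrier ?PP" using that relations_subset by blast
      ultimately show ?thesis using eval zero PP.a_rcos_zero[OF I.is_ideal] by (simp add: \<chi>_def)
    qed
    thus ?thesis using w by (simp add: zero_set_def)
  qed
  \<comment> \<open>Surjectivity of the coordinate map turns the zero \<open>w\<close> into the
    universal point.\<close>
  then obtain A where A: "A \<in> points Q m \<Gamma>" "coords_over Q m \<Gamma> A = w"
    using bij_betw_imp_surj_on[OF coords_over_bij[OF alg]] by (metis imageE)
  hence "(Q, \<phi>, A) \<in> all_points m \<Gamma>" using alg by (simp add: all_points_def)
  \<comment> \<open>The value of the zero function at the universal point is compared with that of
    p, which is the residue class of p.\<close>
  hence "\<chi> p = \<zero>\<^bsub>Q\<^esub>"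
    using fun_cong[OF 0, of "(Q, \<phi>, A)"] A(2) eval[OF p] by (simp add: reg_fun_def reg_ring_def)
  thus ?thesis using I.rcos_const_imp_mem[OF p] zero by (simp add: \<chi>_def)
qed

text \<open>Coordinates of points are zeros of the relations, so the ideal lies in the kernel; the
  universal point gives the other inclusion.\<close>

lemma reg_fun_kernel:
  "a_kernel (PP m \<Gamma>) (reg_ring m \<Gamma>) (reg_fun m \<Gamma>) = Idl\<^bsub>PP m \<Gamma>\<^esub> (relations m \<Gamma> a :: 'k::field mpoly set)"
proof -
  interpret h: ring_hom_ring "PP m \<Gamma> :: 'k mpoly ring" "reg_ring m \<Gamma>" "reg_fun m \<Gamma>"
    by (rule reg_fun_ring_hom_ring)
  have ker: "p \<in> a_kernel (PP m \<Gamma>) (reg_ring m \<Gamma>) (reg_fun m \<Gamma>) \<longleftrightarrow>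
      p \<in> carrier (PP m \<Gamma>) \<and> reg_fun m \<Gamma> p = \<zero>\<^bsub>reg_ring m \<Gamma>\<^esub>" for p :: "'k mpoly"
    unfolding a_kernel_def' by blast
  have "reg_fun m \<Gamma> p = \<zero>\<^bsub>reg_ring m \<Gamma>\<^esub>" if "p \<in> relations m \<Gamma> a" for p :: "'k mpoly"
  proof -
    have "mpoly_eval R \<phi> (coords_over R m \<Gamma> A) p = \<zero>\<^bsub>R\<^esub>" if "(R, \<phi>, A) \<in> all_points m \<Gamma>"
      for R :: "'k mpoly set ring" and \<phi> A
      using coords_over_closed(1)[OF all_pointsD[OF that]] \<open>p \<in> relations m \<Gamma> a\<close>
      by (simp add: zero_set_def)
    thus ?thesis by (auto simp: reg_fun_def reg_ring_def intro!: restrict_ext)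
  qed
  hence "relations m \<Gamma> a \<subseteq> a_kernel (PP m \<Gamma>) (reg_ring m \<Gamma>) (reg_fun m \<Gamma> :: 'k mpoly \<Rightarrow> _)"
    by (auto simp: ker intro: subsetD[OF relations_subset])
  hence "Idl\<^bsub>PP m \<Gamma>\<^esub> (relations m \<Gamma> a) \<subseteq> a_kernel (PP m \<Gamma>) (reg_ring m \<Gamma>) (reg_fun m \<Gamma> :: 'k mpoly \<Rightarrow> _)"
    by (rule h.R.genideal_minimal[OF h.kernel_is_ideal])
  thus ?thesis using ker by (auto intro: reg_fun_eq_zero_imp)
qed

text \<open>The first isomorphism theorem; surjectivity is built into the carrier of
  \<open>reg_ring\<close>. The formula for h says that the classes of the variables go to the
  coordinate functions.\<close>

lemma reg_ring_iso:
  "\<exists>h \<in> ring_iso (PP m \<Gamma> Quot (Idl\<^bsub>PP m \<Gamma>\<^esub> (relations m \<Gamma> a))) (reg_ring m \<Gamma>).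
    \<forall>p\<in>carrier (PP m \<Gamma> :: 'k::field mpoly ring).
      h (Idl\<^bsub>PP m \<Gamma>\<^esub> (relations m \<Gamma> a) +>\<^bsub>PP m \<Gamma>\<^esub> p) = reg_fun m \<Gamma> p"
proof -
  interpret h: ring_hom_ring "PP m \<Gamma> :: 'k mpoly ring" "reg_ring m \<Gamma>" "reg_fun m \<Gamma>"
    by (rule reg_fun_ring_hom_ring)
  have "reg_fun m \<Gamma> ` carrier (PP m \<Gamma> :: 'k mpoly ring) = carrier (reg_ring m \<Gamma>)"
    by (simp add: reg_ring_def)
  from h.FactRing_iso_set[OF this] show ?thesis
    unfolding reg_fun_kernel
    by (rule bexI[rotated]) (simp add: h.the_elem_simp[unfolded reg_fun_kernel])
qed

end

theorem theorem4p2: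
  fixes m :: nat and \<Gamma> :: "nat set" and a :: "nat \<Rightarrow> nat \<Rightarrow> nat"
  assumes "m \<ge> 4" and "\<Gamma> \<in> SS m"
    and "card (ind \<Gamma>) \<ge> 2" and "dec_ge2 \<Gamma> \<noteq> {}"
    and "\<forall>\<gamma>\<in>dec \<Gamma>. a \<gamma> \<in> Rel \<Gamma> \<gamma>"
    and "\<forall>\<nu>\<in>ind \<Gamma>. a \<nu> = unit_vec \<nu>"
  shows "card (Idx m \<Gamma>) = (\<Sum>\<nu>\<in>ind \<Gamma>. card (CC m \<Gamma> \<nu>))
    \<and> (relations m \<Gamma> a :: 'k::field mpoly set) \<subseteq> carrier (PP m \<Gamma>)
    \<and> (relations_deriv m \<Gamma> a :: 'k mpoly set) = relations m \<Gamma> a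
    \<and> bij_betw (coords m \<Gamma>) (algebras_of_type m \<Gamma> :: 'k poly set set)
        (zero_set ring_of_type_algebra (\<lambda>c. c) m \<Gamma> (relations m \<Gamma> a :: 'k mpoly set))
    \<and> (\<forall>(R :: 'r ring) (\<phi> :: 'k \<Rightarrow> 'r). comm_algebra R \<phi> \<longrightarrow>
        bij_betw (coords_over R m \<Gamma>) (points R m \<Gamma>) (zero_set R \<phi> m \<Gamma> (relations m \<Gamma> a)))
    \<and> (\<exists>h \<in> ring_iso (PP m \<Gamma> Quot (Idl\<^bsub>PP m \<Gamma>\<^esub> (relations m \<Gamma> a))) (reg_ring m \<Gamma>).
        \<forall>p\<in>carrier (PP m \<Gamma> :: 'k mpoly ring).
          h (Idl\<^bsub>PP m \<Gamma>\<^esub> (relations m \<Gamma> a) +>\<^bsub>PP m \<Gamma>\<^esub> p) = reg_fun m \<Gamma> p)"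
proof -
  interpret gamma_setup m \<Gamma> a by unfold_locales (fact assms)+
  have "card (Idx m \<Gamma>) = (\<Sum>\<nu>\<in>ind \<Gamma>. card (CC m \<Gamma> \<nu>))"
    unfolding Idx_def by (rule card_SigmaI) (simp_all add: finite_ind)
  moreover have "(relations_deriv m \<Gamma> a :: 'k mpoly set) = relations m \<Gamma> a"
    by (simp add: relations_deriv_def relations_def poly_divided_deriv_0)
  ultimately show ?thesis
    by (intro conjI allI impI relations_subset coords_bij coords_over_bij reg_ring_iso)
qed

end
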